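(* Let $\mathcal{H}\cong\mathbb{C}^d$, let $\mathcal{F}_0=\{f_i\}_{i=1}^{n_0}\in\mathcal{H}^{n_0}$, let $n>n_0$ be an integer, $k=n-n_0$, and assume $\operatorname{rk}S_{\mathcal{F}_0}\ge d-k$. Let $\mathbf{a}=(\alpha_i)_{i=1}^n\in\mathbb{R}_{>0}^n$ with $\|f_i\|^2=\alpha_i$ for $1\le i\le n_0$, and let $\mathbf{b}=(\alpha_i)_{i=n_0+1}^n$. Let $\nu=\nu(\mathcal{F}_0,\mathbf{a})$ and $\mu=\mu(\mathcal{F}_0,\mathbf{a})$ be as defined in the context and assume that $\mathbf{b}\prec\mu$. Then: \begin{enumerate} \item Any $\mathcal{F}\in\mathcal{C}_{\mathbf{a}}(\mathcal{F}_0)$ such that $\lambda(S_{\mathcal{F}})=\nu$ satisfies $$\sum_{i=1}^df(\nu_i)=P_f(\mathcal{F})\le P_f(\mathcal{G})\quad\text{for every }\mathcal{G}\in\mathcal{C}_{\mathbf{a}}(\mathcal{F}_0)$$ and every (not necessarily increasing) convex function $f:[0,\infty)\to[0,\infty)$. \item If $f:[0,\infty)\to[0,\infty)$ is strictly convex, then every global minimizer $\mathcal{F}'$ of $P_f$ on $\mathcal{C}_{\mathbf{a}}(\mathcal{F}_0)$ satisfies $\lambda(S_{\mathcal{F}'})=\nu$. \end{enumerate} In particular, items 1 and 2 hold for the Benedetto–Fickus potential $\mathcal{F}\mapsto\operatorname{tr}(S_{\mathcal{F}}^2)$ and for the mean square error $\mathcal{F}\mapsto\operatorname{tr}(S_{\mathcal{F}}^{-1})$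 (in place of $P_f$).
   Context: For a finite sequence $\mathcal{G}=\{g_i\}$ in $\mathcal{H}$, its frame operator is $S_{\mathcal{G}}=\sum_i g_i\otimes g_i$, where $(x\otimes y)z=\langle z,y\rangle x$. $\mathbf{F}(n,d)$ is the set of $(n,d)$-frames, i.e. sequences of $n$ vectors spanning $\mathcal{H}$. $\lambda(S)$ is the vector of eigenvalues of a positive semidefinite $S$ counted with multiplicity in decreasing order. For convex $f:[0,\infty)\to[0,\infty)$ the frame potential is $P_f(\mathcal{F})=\operatorname{tr}(f(S_{\mathcal{F}}))$. Majorization: $x\prec y$ means $\sum_{i\le j}x_i^\downarrow\le\sum_{i\le j}y_i^\downarrow$ for all $j$, with equality of total sums ($\downarrow$ = decreasing rearrangement); vectors with nonnegative entries of different lengths are compared after completing the shorter one with zeros. $$\mathcal{C}_{\mathbf{a}}(\mathcal{F}_0)=\{\{f_i\}_{i=1}^n\in\mathbf{F}(n,d):\ \{f_i\}_{i=1}^{n_0}=\mathcal{F}_0,\ \|f_i\|^2=\alpha_i\text{ for }i\ge n_0+1\}.$$ Let $\lambda\in\mathbb{R}^d$ have nonnegative decreasing entries, $t_0=\sum_i\lambda_i$. For $t\ge t_0$ and $q\in\{0,\dots,d-1\}$ let $p_\lambda(q,t)=\frac{t-\sum_{j=1}^q\lambda_j}{d-q}$, and $$r_\lambda(t)=\min\{q\in\{0,\dots,d-1\}:p_\lambda(q,t)\ge\lambda_{q+1}\},\qquad c_\lambda(t)=p_\lambda(r_\lambda(t),t).$$ For $1\le m\le d-1$ let $s^*=\sum_{i=1}^m\lambda_i+(d-m)\lambda_m$,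 $s^{**}=(d-m)\lambda_1+\sum_{j=1}^m\lambda_j$, and for $t\ge t_0$ $$c_{\lambda,m}(t)=\begin{cases}c_\lambda(t)& t\le s^*\\ \lambda_m+\frac{t-s^*}{d-m}& t>s^*\end{cases},\qquad r_{\lambda,m}(t)=\min\{q\in\{0,\dots,d-1\}:c_{\lambda,m}(t)\ge\lambda_{q+1}\}.$$ For $m\le0$ set $c_{\lambda,m}=c_\lambda$ and $r_{\lambda,m}=r_\lambda$. With $\lambda=\lambda(S_{\mathcal{F}_0})$, $m=d-k$, $t=\sum_{i=1}^n\alpha_i$, put $c=c_{\lambda,m}(t)$, $\rho=r_{\lambda,m}(t)$, $r=\max\{r_{\lambda,m}(t),m\}$, $\mu=\mu(\mathcal{F}_0,\mathbf{a})=(c-\lambda_{r+j})_{j=1}^{d-r}$, and, with $\mathbf{1}_q$ the all-ones vector of length $q$, define $\nu=\nu(\mathcal{F}_0,\mathbf{a})\in\mathbb{R}^d$ by: $\nu=(\lambda_1,\dots,\lambda_\rho,c\,\mathbf{1}_{d-\rho})$ if $m\le0$, or if $m\ge1$ and $t\le s^*$; $\nu=(\lambda_1,\dots,\lambda_\rho,c\,\mathbf{1}_{d-m},\lambda_{\rho+1},\dots,\lambda_m)$ if $m\ge1$ and $s^*<t<s^{**}$; $\nu=(c\,\mathbf{1}_{d-m},\lambda_1,\dots,\lambda_m)$ if $m\ge1$ and $t\ge s^{**}$. *)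

theory Defs
  imports
    "HOL-Analysis.Convex"
    "Jordan_Normal_Form.Schur_Decomposition"
    "Jordan_Normal_Form.Gauss_Jordan_Elimination"
    "Jordan_Normal_Form.Char_Poly"
    "Jordan_Normal_Form.DL_Rank"
begin

text \<open>The Hilbert space of dimension d is \<^term>\<open>carrier_vec d :: complex vec set\<close> with the
  inner product \<^term>\<open>v \<bullet>c w\<close>, which is linear in v and conjugate-linear in w. Finite sequences
  of vectors and vectors of reals are lists; lists are indexed from 0, so the mathematical
  entry with index j is \<^term>\<open>xs ! (j - 1)\<close>.\<close>

definition sqnorm :: "complex vec \<Rightarrow> real" where
  "sqnorm v = Re (v \<bullet>c v)"

definition rank_one :: "complex vec \<Rightarrow> complex vec \<Rightarrow> complex mat" where
  "rank_one x y = mat (dim_vec x) (dim_vec y) (\<lambda>(i, j). x $ i * conjugate (y $ j))"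

lemma rank_one_mult_vec:
  assumes "z \<in> carrier_vec (dim_vec y)"
  shows "rank_one x y *\<^sub>v z = (z \<bullet>c y) \<cdot>\<^sub>v x"
proof (rule eq_vecI)
  fix i assume "i < dim_vec ((z \<bullet>c y) \<cdot>\<^sub>v x)"
  then show "(rank_one x y *\<^sub>v z) $ i = ((z \<bullet>c y) \<cdot>\<^sub>v x) $ i"
    using assms
    by (auto simp: rank_one_def scalar_prod_def sum_distrib_left mult_ac intro!: sum.cong)
qed (simp add: rank_one_def)

definition frame_operator :: "nat \<Rightarrow> complex vec list \<Rightarrow> complex mat" where
  "frame_operator d G = foldr (\<lambda>g A. rank_one g g + A) G (0\<^sub>m d d)"

definition frames :: "nat \<Rightarrow> nat \<Rightarrow> complex vec list set" where
  "frames n d = {F. length F = n \<and> set F \<subseteq> carrier_vec d \<and>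
     LinearCombinations.module.span class_ring (module_vec TYPE(complex) d) (set F) = carrier_vec d}"

text \<open>Roots of the characteristic polynomial with multiplicity, in decreasing order. The function
  is meant for positive semidefinite (or just Hermitian) S, where all these roots are real and
  taking real parts loses nothing.\<close>

definition eigenvalue_vector :: "complex mat \<Rightarrow> real list" where
  "eigenvalue_vector S = rev (sorted_list_of_multiset (image_mset Re (proots (char_poly S))))"

definition mat_trace :: "complex mat \<Rightarrow> complex" where
  "mat_trace A = (\<Sum>i<dim_row A. A $$ (i, i))"

text \<open>Functional calculus for a Hermitian matrix: if S is the unitary conjugate of a real diagonal
  matrix, apply f to the diagonal entries. The result does not depend on the diagonalization.\<close>

definition mat_fun :: "(real \<Rightarrow> real) \<Rightarrow> complex mat \<Rightarrow> complex mat" where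
  "mat_fun f S = (let d = dim_row S in
     THE B. \<exists>U (a :: nat \<Rightarrow> real). U \<in> carrier_mat d d \<and> mat_adjoint U * U = 1\<^sub>m d \<and>
       S = U * mat_diag d (\<lambda>i. complex_of_real (a i)) * mat_adjoint U \<and>
       B = U * mat_diag d (\<lambda>i. complex_of_real (f (a i))) * mat_adjoint U)"

text \<open>The traces below are real numbers, as they are traces of Hermitian matrices; \<^const>\<open>Re\<close> only
  changes the type.\<close>

definition frame_potential :: "nat \<Rightarrow> (real \<Rightarrow> real) \<Rightarrow> complex vec list \<Rightarrow> real" where
  "frame_potential d f F = Re (mat_trace (mat_fun f (frame_operator d F)))"

definition benedetto_fickus_potential :: "nat \<Rightarrow> complex vec list \<Rightarrow> real" where
  "benedetto_fickus_potential d F = Re (mat_trace (frame_operator d F * frame_operator d F))"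

text \<open>For a frame F the frame operator is invertible, so \<^const>\<open>mat_inverse\<close> is not \<^const>\<open>None\<close>.\<close>

definition mean_square_error :: "nat \<Rightarrow> complex vec list \<Rightarrow> real" where
  "mean_square_error d F = Re (mat_trace (the (mat_inverse (frame_operator d F))))"

definition strictly_convex_on :: "real set \<Rightarrow> (real \<Rightarrow> real) \<Rightarrow> bool" where
  "strictly_convex_on A f \<longleftrightarrow> convex A \<and>
     (\<forall>x\<in>A. \<forall>y\<in>A. \<forall>u. x \<noteq> y \<longrightarrow> 0 < u \<longrightarrow> u < 1 \<longrightarrow>
        f (u * x + (1 - u) * y) < u * f x + (1 - u) * f y)"

definition decreasing_padded :: "nat \<Rightarrow> real list \<Rightarrow> real list" where
  "decreasing_padded N x = rev (sort (x @ replicate (N - length x) 0))"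

text \<open>Majorization; the shorter of two lists of different lengths is completed with zeros.\<close>

definition majorized :: "real list \<Rightarrow> real list \<Rightarrow> bool"  (infix \<open>\<prec>\<^sub>m\<close> 50) where
  "x \<prec>\<^sub>m y \<longleftrightarrow> (let N = max (length x) (length y) in
     (\<forall>j\<le>N. sum_list (take j (decreasing_padded N x)) \<le> sum_list (take j (decreasing_padded N y))) \<and>
     sum_list x = sum_list y)"

definition completions :: "nat \<Rightarrow> complex vec list \<Rightarrow> real list \<Rightarrow> complex vec list set" where
  "completions d F0 a = {F \<in> frames (length a) d.
     take (length F0) F = F0 \<and> (\<forall>i. length F0 \<le> i \<and> i < length a \<longrightarrow> sqnorm (F ! i) = a ! i)}"

text \<open>In what follows \<open>lam\<close> is a decreasing list of d = \<^term>\<open>length lam\<close> nonnegative reals. The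
  parameter m is a natural number obtained from the integer d - k by truncation, so that m = 0
  stands for all of the cases where the integer is at most 0.\<close>

definition p_lam :: "real list \<Rightarrow> nat \<Rightarrow> real \<Rightarrow> real" where
  "p_lam lam q t = (t - sum_list (take q lam)) / (real (length lam) - real q)"

definition r_lam :: "real list \<Rightarrow> real \<Rightarrow> nat" where
  "r_lam lam t = (LEAST q. q < length lam \<and> p_lam lam q t \<ge> lam ! q)"

definition c_lam :: "real list \<Rightarrow> real \<Rightarrow> real" where
  "c_lam lam t = p_lam lam (r_lam lam t) t"

definition s_star :: "real list \<Rightarrow> nat \<Rightarrow> real" where
  "s_star lam m = sum_list (take m lam) + (real (length lam) - real m) * lam ! (m - 1)"

definition s_star_star :: "real list \<Rightarrow> nat \<Rightarrow> real" where
  "s_star_star lam m = (real (length lam) - real m) * lam ! 0 + sum_list (take m lam)"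

definition c_lam_m :: "real list \<Rightarrow> nat \<Rightarrow> real \<Rightarrow> real" where
  "c_lam_m lam m t =
     (if m = 0 \<or> t \<le> s_star lam m then c_lam lam t
      else lam ! (m - 1) + (t - s_star lam m) / (real (length lam) - real m))"

definition r_lam_m :: "real list \<Rightarrow> nat \<Rightarrow> real \<Rightarrow> nat" where
  "r_lam_m lam m t =
     (if m = 0 then r_lam lam t
      else (LEAST q. q < length lam \<and> c_lam_m lam m t \<ge> lam ! q))"

definition mu_list :: "real list \<Rightarrow> nat \<Rightarrow> real \<Rightarrow> real list" where
  "mu_list lam m t =
     (let c = c_lam_m lam m t; r = max (r_lam_m lam m t) m
      in map (\<lambda>j. c - lam ! j) [r..<length lam])"

definition nu_list :: "real list \<Rightarrow> nat \<Rightarrow> real \<Rightarrow> real list" where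
  "nu_list lam m t =
     (let d = length lam; c = c_lam_m lam m t; \<rho> = r_lam_m lam m t in
      if m = 0 \<or> t \<le> s_star lam m then take \<rho> lam @ replicate (d - \<rho>) c
      else if t < s_star_star lam m
        then take \<rho> lam @ replicate (d - m) c @ drop \<rho> (take m lam)
      else replicate (d - m) c @ take m lam)"

definition mu_vec :: "nat \<Rightarrow> complex vec list \<Rightarrow> real list \<Rightarrow> real list" where
  "mu_vec d F0 a = mu_list (eigenvalue_vector (frame_operator d F0))
     (d - (length a - length F0)) (sum_list a)"

definition nu_vec :: "nat \<Rightarrow> complex vec list \<Rightarrow> real list \<Rightarrow> real list" where
  "nu_vec d F0 a = nu_list (eigenvalue_vector (frame_operator d F0))
     (d - (length a - length F0)) (sum_list a)"

end

theory Submission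
  imports Defs
begin

text \<open>Let x be the spectrum of an arbitrary completion and lam that of the frame operator of F0. As a
  sum of k rank one operators is added, the Weyl inequalities give lam_i \<open>\<le>\<close> x_i and
  x_(i+k) \<open>\<le>\<close> lam_i. The vector \<open>\<nu>\<close> consists of entries of lam that exceed the level c, then of
  copies of c, then of entries of lam that are at most c, shifted by k places. Hence every \<open>\<nu>\<close>_i lies
  between c and x_i. Since both vectors have the same sum, adding a linear function to f does not
  matter, so c may be taken to be a minimum point of f; then f(\<open>\<nu>\<close>_i) \<open>\<le>\<close> f(x_i) for each i, with
  equality only for \<open>\<nu>\<close>_i = x_i if f is strictly convex. That a completion with spectrum \<open>\<nu>\<close> exists,
  so that minimizers attain the bound, follows from the majorization hypothesis by the Schur-Horn
  theorem: scaled eigenvectors of the frame operator of F0, which raise the trailing eigenvalues to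
  c, are rotated in pairs until they have the prescribed norms.\<close>

section \<open>Complex vectors and traces\<close>

text \<open>Since f need not be increasing, bounds on a spectrum from one side would not suffice;
  the equality of the sums, which is an equality of traces, is what permits the tilt by a linear
  function. The tilt takes a supporting line at c, so c has to be an interior point of the half
  line: \<open>mu\<close> has the same sum as b, which is positive, and this forces c > 0. Convexity
  is used on the positive reals only; they contain c and the spectrum of every frame, and the
  function 1/x then falls under the same argument as f. The shift by k places is exact: trailing
  entries of lam come after the copies of c only if rho < m; then m = d - k without truncation and c
  is repeated d - m = k times, so the entry at such an index i is lam_(i-k), the very one that the
  second Weyl inequality compares with x_i. The rank hypothesis makes the d - k leading entries of
  lam positive. Thus the constructed sequence has a positive spectrum, and for this reason it spans
  the space and is a completion.\<close>

lemma mat_adjoint_index [simp]: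
  "i < dim_col A \<Longrightarrow> j < dim_row A \<Longrightarrow> mat_adjoint A $$ (i, j) = conjugate (A $$ (j, i))"
  by (simp add: mat_adjoint_def mat_of_rows_def)

lemma mat_adjoint_dim [simp]:
  "dim_row (mat_adjoint A) = dim_col A" "dim_col (mat_adjoint A) = dim_row A"
  by (simp_all add: mat_adjoint_def)

lemma mat_adjoint_carrier [simp]:
  "A \<in> carrier_mat n m \<Longrightarrow> mat_adjoint A \<in> carrier_mat m n"
  by (auto intro: carrier_matI)

lemma cscalar_prod_sum:
  "w \<in> carrier_vec n \<Longrightarrow> v \<bullet>c w = (\<Sum>i<n. v $ i * conjugate (w $ i))"
  by (auto simp: scalar_prod_def lessThan_atLeast0)

lemma cscalar_prod_swap:
  fixes v w :: "complex vec"
  assumes "v \<in> carrier_vec n" "w \<in> carrier_vec n"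
  shows "w \<bullet>c v = cnj (v \<bullet>c w)"
  using assms by (simp add: cscalar_prod_sum mult.commute)

lemma cscalar_prod_add_left:
  assumes "u \<in> carrier_vec n" "v \<in> carrier_vec n" "w \<in> carrier_vec n"
  shows "(u + v) \<bullet>c w = u \<bullet>c w + v \<bullet>c (w :: complex vec)"
  using assms by (simp add: add_scalar_prod_distrib[of _ n])

lemma cscalar_prod_adjoint:
  fixes A :: "complex mat"
  assumes A: "A \<in> carrier_mat n m" and x: "x \<in> carrier_vec m" and y: "y \<in> carrier_vec n"
  shows "(A *\<^sub>v x) \<bullet>c y = x \<bullet>c (mat_adjoint A *\<^sub>v y)"
proof -
  have "(A *\<^sub>v x) \<bullet>c y = (\<Sum>i<n. \<Sum>j<m. A $$ (i, j) * x $ j * cnj (y $ i))"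
    using A x y
    by (auto simp: cscalar_prod_sum[of _ n] scalar_prod_def lessThan_atLeast0 sum_distrib_right)
  also have "\<dots> = (\<Sum>j<m. \<Sum>i<n. A $$ (i, j) * x $ j * cnj (y $ i))"
    by (rule sum.swap)
  also have "\<dots> = x \<bullet>c (mat_adjoint A *\<^sub>v y)"
    using A x y
    by (auto simp: cscalar_prod_sum[of _ m] scalar_prod_def lessThan_atLeast0 sum_distrib_left
        mult_ac)
  finally show ?thesis .
qed

lemma cscalar_prod_self: "v \<bullet>c v = complex_of_real (sqnorm v)"
  using conjugate_square_ge_0_vec[of v] by (simp add: sqnorm_def complex_eq_iff less_eq_complex_def)

lemma sqnorm_eq_0_iff: "sqnorm v = 0 \<longleftrightarrow> v = 0\<^sub>v (dim_vec v)"
  using conjugate_square_eq_0_vec[of v "dim_vec v"] by (simp add: cscalar_prod_self)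

lemma sqnorm_nonneg: "sqnorm v \<ge> 0"
  using conjugate_square_ge_0_vec[of v] by (simp add: sqnorm_def less_eq_complex_def)

lemma sqnorm_smult: "sqnorm (c \<cdot>\<^sub>v v) = (cmod c)\<^sup>2 * sqnorm v"
proof -
  have "(c \<cdot>\<^sub>v v) \<bullet>c (c \<cdot>\<^sub>v v) = c * cnj c * (v \<bullet>c v)"
    by (simp add: conjugate_smult_vec)
  then show ?thesis
    by (simp add: cscalar_prod_self flip: complex_norm_square) (metis Re_complex_of_real of_real_mult of_real_power)
qed

text \<open>Fewer than d homogeneous linear conditions on d unknowns have a nonzero solution. This
  is the dimension count behind the Weyl inequalities.\<close>

lemma ex_orthogonal_vec:
  fixes ws :: "complex vec list"
  assumes ws: "set ws \<subseteq> carrier_vec d" and len: "length ws < d"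
  shows "\<exists>z \<in> carrier_vec d. z \<noteq> 0\<^sub>v d \<and> (\<forall>w \<in> set ws. z \<bullet>c w = 0)"
proof -
  \<comment> \<open>Padding with zero rows makes the system square. The last row is zero because
    \<open>length ws < d\<close>, so the transpose kills the last unit vector and M is
    singular.\<close>
  define M where "M = mat d d (\<lambda>(i, j). if i < length ws then cnj (ws ! i $ j) else 0)"
  have M: "M \<in> carrier_mat d d" by (simp add: M_def)
  have "transpose_mat M *\<^sub>v unit_vec d (d - 1) = 0\<^sub>v d"
    using len by (intro eq_vecI) (auto simp: M_def)
  moreover have "unit_vec d (d - 1) \<noteq> (0\<^sub>v d :: complex vec)"
    using len by (simp add: unit_vec_nonzero)
  ultimately have "det (transpose_mat M) = 0"
    using det_0_iff_vec_prod_zero_field[of "transpose_mat M" d] M by force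
  then have "det M = 0" using det_transpose[OF M] by simp
  then obtain z where z: "z \<in> carrier_vec d" "z \<noteq> 0\<^sub>v d" "M *\<^sub>v z = 0\<^sub>v d"
    using det_0_iff_vec_prod_zero_field[OF M] by blast
  have "z \<bullet>c w = 0" if w: "w \<in> set ws" for w
  proof -
    obtain i where i: "i < length ws" "w = ws ! i" using w by (auto simp: in_set_conv_nth)
    then have "w \<in> carrier_vec d" using ws by auto
    then have "z \<bullet>c w = (M *\<^sub>v z) $ i"
      using i len z(1)
      by (auto simp: cscalar_prod_sum[of _ d] M_def scalar_prod_def lessThan_atLeast0 mult.commute)
    then show ?thesis using z(3) i len by simp
  qed
  then show ?thesis using z by blast
qed

lemma mat_trace_mult_commute:
  assumes "A \<in> carrier_mat n m" "B \<in> carrier_mat m n"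
  shows "mat_trace (A * B) = mat_trace (B * A)"
proof -
  have "mat_trace (A * B) = (\<Sum>i<n. \<Sum>j<m. A $$ (i, j) * B $$ (j, i))"
    using assms by (auto simp: mat_trace_def scalar_prod_def lessThan_atLeast0)
  also have "\<dots> = (\<Sum>j<m. \<Sum>i<n. A $$ (i, j) * B $$ (j, i))" by (rule sum.swap)
  also have "\<dots> = mat_trace (B * A)"
    using assms by (auto simp: mat_trace_def scalar_prod_def lessThan_atLeast0 mult.commute)
  finally show ?thesis .
qed

text \<open>Schur triangularization puts the roots on the diagonal, and the trace is invariant under
  similarity.\<close>

lemma mat_trace_char_poly:
  assumes A: "A \<in> carrier_mat n n" and es: "char_poly A = (\<Prod>a\<leftarrow>es. [:- a, 1:])"
  shows "mat_trace A = sum_list es"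
proof -
  obtain B P Q where "schur_decomposition A es = (B, P, Q)"
    by (cases "schur_decomposition A es")
  then have sim: "similar_mat_wit A B P Q" and es: "diag_mat B = es"
    using schur_decomposition[OF A es] by auto
  note s = similar_mat_witD2[OF A sim]
  have "mat_trace A = mat_trace (P * (B * Q))" using s by (simp add: assoc_mult_mat[of _ n n _ n _ n])
  also have "\<dots> = mat_trace (B * Q * P)" using s by (intro mat_trace_mult_commute) auto
  also have "\<dots> = mat_trace B" using s by (simp add: assoc_mult_mat[of _ n n _ n _ n])
  also have "\<dots> = sum_list es"
    using s by (simp add: mat_trace_def es[symmetric] diag_mat_def interv_sum_list_conv_sum_set_nat
        lessThan_atLeast0)
  finally show ?thesis .
qed

lemma mat_trace_single_eigenvalue:
  assumes A: "A \<in> carrier_mat n n" and ev: "\<And>e. eigenvalue A e \<Longrightarrow> e = s"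
  shows "mat_trace A = of_nat n * s"
proof -
  obtain es where es: "char_poly A = (\<Prod>a\<leftarrow>es. [:- a, 1:])" "length es = n"
    using char_poly_factorized[OF A] by blast
  have "e = s" if "e \<in> set es" for e
  proof -
    have "poly (char_poly A) e = 0"
      using that unfolding es by (auto simp: poly_prod_list prod_list_zero_iff)
    then show ?thesis using ev eigenvalue_root_char_poly[OF A] by blast
  qed
  then have "es = replicate n s" using es(2) by (metis replicate_eqI)
  then show ?thesis using mat_trace_char_poly[OF A es(1)] by (simp add: sum_list_replicate)
qed

text \<open>The matrices B s agree with A on the orthogonal complement of the given eigenvectors,
  on whose span they act as the scalar s. If B 0 and B 1 had no eigenvalues
  besides 0 and 1 respectively, then the difference of their traces would be d; but it is the number
  of given eigenvectors.\<close>

lemma ex_orthogonal_eigenvector: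
  fixes A :: "complex mat" and l :: "nat \<Rightarrow> real"
  assumes A: "A \<in> carrier_mat d d" and herm: "mat_adjoint A = A"
    and vs: "set vs \<subseteq> carrier_vec d" and len: "length vs < d"
    and on: "\<And>i j. i < length vs \<Longrightarrow> j < length vs \<Longrightarrow> vs ! i \<bullet>c vs ! j = (if i = j then 1 else 0)"
    and ev: "\<And>i. i < length vs \<Longrightarrow> A *\<^sub>v (vs ! i) = complex_of_real (l i) \<cdot>\<^sub>v (vs ! i)"
  shows "\<exists>w e. w \<in> carrier_vec d \<and> w \<bullet>c w = 1 \<and> (\<forall>v \<in> set vs. w \<bullet>c v = 0) \<and>
    A *\<^sub>v w = complex_of_real e \<cdot>\<^sub>v w"
proof -
  define p where "p = length vs"
  have vsc [simp]: "vs ! i \<in> carrier_vec d" if "i < p" for i using vs that by (auto simp: p_def)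
  have vsd [simp]: "dim_vec (vs ! i) = d" if "i < p" for i
    using vsc[OF that] by simp
  define B where "B s = mat d d (\<lambda>(i, j). A $$ (i, j) +
    (\<Sum>q<p. complex_of_real (s - l q) * (vs ! q $ i) * cnj (vs ! q $ j)))" for s :: real
  have B [simp]: "B s \<in> carrier_mat d d" for s by (simp add: B_def)
  have Bd [simp]: "dim_row (B s) = d" "dim_col (B s) = d" for s by (simp_all add: B_def)
  have Bv: "B s *\<^sub>v z = A *\<^sub>v z + vec d (\<lambda>i. \<Sum>q<p. complex_of_real (s - l q) * (z \<bullet>c vs ! q) * (vs ! q $ i))"
    if z: "z \<in> carrier_vec d" for s z
  proof (rule eq_vecI)
    fix i assume "i < dim_vec (A *\<^sub>v z + vec d (\<lambda>i. \<Sum>q<p. complex_of_real (s - l q) * (z \<bullet>c vs ! q) * (vs ! q $ i)))"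
    then have i: "i < d" by simp
    have "(B s *\<^sub>v z) $ i = (\<Sum>j<d. A $$ (i, j) * z $ j) +
      (\<Sum>j<d. \<Sum>q<p. complex_of_real (s - l q) * (vs ! q $ i) * cnj (vs ! q $ j) * z $ j)"
      using z i by (simp add: B_def scalar_prod_def lessThan_atLeast0 distrib_right sum.distrib
          sum_distrib_right)
    also have "(\<Sum>j<d. \<Sum>q<p. complex_of_real (s - l q) * (vs ! q $ i) * cnj (vs ! q $ j) * z $ j)
      = (\<Sum>q<p. complex_of_real (s - l q) * (z \<bullet>c vs ! q) * (vs ! q $ i))"
      by (subst sum.swap, intro sum.cong refl)
         (simp add: cscalar_prod_sum[of _ d] sum_distrib_left sum_distrib_right mult_ac)
    also have "(\<Sum>j<d. A $$ (i, j) * z $ j) = (A *\<^sub>v z) $ i"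
      using A z i by (simp add: scalar_prod_def lessThan_atLeast0)
    finally show "(B s *\<^sub>v z) $ i =
      (A *\<^sub>v z + vec d (\<lambda>i. \<Sum>q<p. complex_of_real (s - l q) * (z \<bullet>c vs ! q) * (vs ! q $ i))) $ i"
      using i by simp
  qed (use A in auto)
  have Bvs: "B s *\<^sub>v (vs ! i) = complex_of_real s \<cdot>\<^sub>v (vs ! i)" if i: "i < p" for s i
  proof (rule eq_vecI)
    fix j assume "j < dim_vec (complex_of_real s \<cdot>\<^sub>v (vs ! i))"
    then have j: "j < d" using i by simp
    have "(\<Sum>q<p. complex_of_real (s - l q) * (vs ! i \<bullet>c vs ! q) * (vs ! q $ j)) =
      (\<Sum>q<p. if i = q then complex_of_real (s - l q) * (vs ! q $ j) else 0)"
      using i on unfolding p_def by (intro sum.cong refl) auto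
    also have "\<dots> = complex_of_real (s - l i) * (vs ! i $ j)" using i by simp
    finally show "(B s *\<^sub>v (vs ! i)) $ j = (complex_of_real s \<cdot>\<^sub>v (vs ! i)) $ j"
      using Bv[of "vs ! i" s] ev[of i] i j by (simp add: p_def algebra_simps)
  qed (use i in auto)
  have Bherm: "mat_adjoint (B s) = B s" for s
  proof (rule eq_matI)
    fix i j assume "i < dim_row (B s)" "j < dim_col (B s)"
    then have ij: "i < d" "j < d" by auto
    have "cnj (A $$ (j, i)) = A $$ (i, j)"
      using herm ij A mat_adjoint_index[of i A j] by simp
    then show "mat_adjoint (B s) $$ (i, j) = B s $$ (i, j)"
      using ij by (simp add: B_def mult_ac)
  qed auto
  have "mat_trace (B 1) - mat_trace (B 0) =
    (\<Sum>i<d. \<Sum>q<p. (vs ! q $ i) * cnj (vs ! q $ i))"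
    by (simp add: mat_trace_def B_def algebra_simps flip: sum_subtractf)
  also have "\<dots> = (\<Sum>q<p. vs ! q \<bullet>c vs ! q)"
    by (subst sum.swap) (simp add: cscalar_prod_sum[of _ d])
  also have "\<dots> = of_nat p" using on by (simp add: p_def)
  finally have tr: "mat_trace (B 1) - mat_trace (B 0) = of_nat p" .
  have "\<exists>s e. eigenvalue (B s) e \<and> e \<noteq> complex_of_real s"
  proof (rule ccontr)
    assume "\<not> ?thesis"
    then have "mat_trace (B s) = of_nat d * complex_of_real s" for s
      using mat_trace_single_eigenvalue[OF B] by blast
    then have "of_nat p = (of_nat d :: complex)" using tr by simp
    then show False using len p_def by simp
  qed
  then obtain s e w where e: "e \<noteq> complex_of_real s" and w: "w \<in> carrier_vec d" "w \<noteq> 0\<^sub>v d"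
    and Bw: "B s *\<^sub>v w = e \<cdot>\<^sub>v w"
    by (auto simp: eigenvalue_def eigenvector_def)
  \<comment> \<open>Eigenvectors of the Hermitian \<open>B s\<close> for different eigenvalues are
    orthogonal; nothing is known yet about e being real, but s is real.\<close>
  have orth: "w \<bullet>c vs ! i = 0" if i: "i < p" for i
  proof -
    have "e * (w \<bullet>c vs ! i) = (B s *\<^sub>v w) \<bullet>c vs ! i" using Bw w i by simp
    also have "\<dots> = w \<bullet>c (B s *\<^sub>v vs ! i)"
      using cscalar_prod_adjoint[OF B w(1) vsc[OF i]] Bherm by simp
    also have "\<dots> = complex_of_real s * (w \<bullet>c vs ! i)"
      using Bvs[OF i] w i by (simp add: conjugate_smult_vec)
    finally show ?thesis using e by simp
  qed
  \<comment> \<open>On vectors orthogonal to all of \<open>vs\<close> the correction terms of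
    \<open>B s\<close> vanish, so w is an eigenvector of A itself.\<close>
  then have Aw: "A *\<^sub>v w = e \<cdot>\<^sub>v w"
    using Bv[OF w(1), of s] Bw A by (intro eq_vecI) (auto simp: vec_eq_iff)
  have "e * (w \<bullet>c w) = (A *\<^sub>v w) \<bullet>c w" using Aw w by simp
  also have "\<dots> = w \<bullet>c (A *\<^sub>v w)" using cscalar_prod_adjoint[OF A w(1) w(1)] herm by simp
  also have "\<dots> = cnj e * (w \<bullet>c w)" using Aw w by (simp add: conjugate_smult_vec)
  finally have "e = cnj e" using w by simp
  then have e': "e = complex_of_real (Re e)" by (metis Reals_cnj_iff of_real_Re)
  define r where "r = complex_of_real (1 / sqrt (sqnorm w))"
  have pos: "sqnorm w > 0" using sqnorm_eq_0_iff[of w] sqnorm_nonneg[of w] w by auto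
  have "(r \<cdot>\<^sub>v w) \<bullet>c (r \<cdot>\<^sub>v w) = complex_of_real (sqnorm (r \<cdot>\<^sub>v w))"
    by (rule cscalar_prod_self)
  also have "\<dots> = 1" using pos by (simp add: sqnorm_smult r_def norm_divide real_sqrt_pow2 power_divide)
  finally have "(r \<cdot>\<^sub>v w) \<bullet>c (r \<cdot>\<^sub>v w) = 1" .
  moreover have "\<forall>v\<in>set vs. (r \<cdot>\<^sub>v w) \<bullet>c v = 0"
    using orth w by (auto simp: in_set_conv_nth p_def)
  moreover have "A *\<^sub>v (r \<cdot>\<^sub>v w) = complex_of_real (Re e) \<cdot>\<^sub>v (r \<cdot>\<^sub>v w)"
    using A w Aw e' by (metis mult_mat_vec mult.commute smult_smult_assoc)
  ultimately show ?thesis using w by (intro exI[of _ "r \<cdot>\<^sub>v w"] exI[of _ "Re e"]) auto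
qed

section \<open>Diagonalization of Hermitian matrices\<close>

text \<open>The same shape as the condition inside \<open>mat_fun\<close>. The diagonal may be in
  any order, because the optimal completion is diagonalized in the eigenbasis of the frame operator
  of F0, where its eigenvalues need not decrease.\<close>

definition diagonalizes :: "nat \<Rightarrow> complex mat \<Rightarrow> complex mat \<Rightarrow> (nat \<Rightarrow> real) \<Rightarrow> bool" where
  "diagonalizes d A U a \<longleftrightarrow> U \<in> carrier_mat d d \<and> mat_adjoint U * U = 1\<^sub>m d \<and>
     A = U * mat_diag d (\<lambda>i. complex_of_real (a i)) * mat_adjoint U"

lemma unitary_right_inverse:
  fixes U :: "complex mat"
  assumes "U \<in> carrier_mat d d" "mat_adjoint U * U = 1\<^sub>m d"
  shows "U * mat_adjoint U = 1\<^sub>m d"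
  using assms mat_mult_left_right_inverse[of "mat_adjoint U" d U] by simp

lemma diagonalizes_carrier: "diagonalizes d A U a \<Longrightarrow> A \<in> carrier_mat d d"
  unfolding diagonalizes_def
  by (metis mat_adjoint_carrier mat_diag_dim mult_carrier_mat)

lemma diag_conj_index:
  fixes U :: "complex mat"
  assumes "U \<in> carrier_mat d d" "i < d" "j < d"
  shows "(U * mat_diag d f * mat_adjoint U) $$ (i, j) = (\<Sum>l<d. U $$ (i, l) * f l * cnj (U $$ (j, l)))"
  using assms by (simp add: mat_diag_mult_right[of _ d d] scalar_prod_def lessThan_atLeast0)

lemma diag_conj_mult:
  fixes U :: "complex mat"
  assumes U: "U \<in> carrier_mat d d" "mat_adjoint U * U = 1\<^sub>m d"
  shows "(U * mat_diag d f * mat_adjoint U) * (U * mat_diag d g * mat_adjoint U) =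
    U * mat_diag d (\<lambda>i. f i * g i) * mat_adjoint U"
proof -
  let ?A = "mat_adjoint U"
  have [simp]: "?A \<in> carrier_mat d d" using U by simp
  have "(U * mat_diag d f * ?A) * (U * mat_diag d g * ?A) =
    U * mat_diag d f * (?A * U) * mat_diag d g * ?A"
    using U(1) by (simp add: assoc_mult_mat[of _ d d _ d _ d] mult_carrier_mat[of _ d d _ d])
  also have "\<dots> = U * (mat_diag d f * mat_diag d g) * ?A"
    using U(1) unfolding U(2)
    by (simp add: assoc_mult_mat[of _ d d _ d _ d] mult_carrier_mat[of _ d d _ d]
        left_mult_one_mat[of _ d d] del: mat_diag_diag)
  finally show ?thesis by simp
qed

lemma mat_trace_diag_conj:
  fixes U :: "complex mat"
  assumes U: "U \<in> carrier_mat d d" "mat_adjoint U * U = 1\<^sub>m d"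
  shows "mat_trace (U * mat_diag d f * mat_adjoint U) = (\<Sum>i<d. f i)"
proof -
  have "mat_trace (U * mat_diag d f * mat_adjoint U) = mat_trace (mat_adjoint U * (U * mat_diag d f))"
    using U by (intro mat_trace_mult_commute[of _ d d]) auto
  also have "mat_adjoint U * (U * mat_diag d f) = mat_adjoint U * U * mat_diag d f"
    using U(1) by (intro assoc_mult_mat[symmetric, of _ d d _ d _ d]) auto
  also have "mat_trace \<dots> = (\<Sum>i<d. f i)"
    unfolding U(2) by (simp add: mat_trace_def mat_diag_def)
  finally show ?thesis .
qed

lemma hermitian_orthonormal_eigenvectors:
  fixes A :: "complex mat"
  assumes A: "A \<in> carrier_mat d d" and herm: "mat_adjoint A = A"
  shows "p \<le> d \<Longrightarrow> \<exists>vs (l :: nat \<Rightarrow> real). length vs = p \<and> set vs \<subseteq> carrier_vec d \<and>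
    (\<forall>i<p. \<forall>j<p. vs ! i \<bullet>c vs ! j = (if i = j then 1 else 0)) \<and>
    (\<forall>i<p. A *\<^sub>v (vs ! i) = complex_of_real (l i) \<cdot>\<^sub>v (vs ! i))"
proof (induction p)
  case 0
  show ?case by auto
next
  case (Suc p)
  then obtain vs and l :: "nat \<Rightarrow> real" where vs: "length vs = p" "set vs \<subseteq> carrier_vec d"
    "\<forall>i<p. \<forall>j<p. vs ! i \<bullet>c vs ! j = (if i = j then 1 else 0)"
    "\<forall>i<p. A *\<^sub>v (vs ! i) = complex_of_real (l i) \<cdot>\<^sub>v (vs ! i)"
    by auto
  obtain w e where w: "w \<in> carrier_vec d" "w \<bullet>c w = 1" "\<forall>v\<in>set vs. w \<bullet>c v = 0"
    "A *\<^sub>v w = complex_of_real e \<cdot>\<^sub>v w"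
    using ex_orthogonal_eigenvector[OF A herm vs(2), of l] vs Suc.prems by auto
  have "\<forall>v\<in>set vs. v \<bullet>c w = 0"
    using w vs(2) cscalar_prod_swap[OF w(1)] by (metis complex_cnj_zero subsetD)
  then show ?case using vs w
    by (intro exI[of _ "vs @ [w]"] exI[of _ "l(p := e)"]) (auto simp: nth_append less_Suc_eq)
qed

lemma hermitian_diagonalizable:
  assumes A: "A \<in> carrier_mat d d" and herm: "mat_adjoint A = A"
  obtains U a where "diagonalizes d A U a" "\<And>i j. i \<le> j \<Longrightarrow> j < d \<Longrightarrow> a j \<le> a i"
proof -
  obtain vs and l :: "nat \<Rightarrow> real" where vs: "length vs = d" "set vs \<subseteq> carrier_vec d"
    and on: "\<forall>i<d. \<forall>j<d. vs ! i \<bullet>c vs ! j = (if i = j then 1 else 0)"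
    and ev: "\<forall>i<d. A *\<^sub>v (vs ! i) = complex_of_real (l i) \<cdot>\<^sub>v (vs ! i)"
    using hermitian_orthonormal_eigenvectors[OF A herm order_refl] by auto
  \<comment> \<open>Sorting the indices by the negated eigenvalue puts the eigenvalues in decreasing
    order.\<close>
  define ixs where "ixs = sort_key (\<lambda>i. - l i) [0..<d]"
  have ixs: "length ixs = d" "distinct ixs" "set ixs = {..<d}"
    by (auto simp: ixs_def distinct_sort)
  have isd: "ixs ! i < d" if "i < d" for i using ixs that nth_mem by blast
  have isi: "ixs ! i = ixs ! j \<longleftrightarrow> i = j" if "i < d" "j < d" for i j
    using ixs that nth_eq_iff_index_eq by blast
  define U where "U = mat d d (\<lambda>(i, j). vs ! (ixs ! j) $ i)"
  have U: "U \<in> carrier_mat d d" by (simp add: U_def)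
  have vsc: "vs ! (ixs ! i) \<in> carrier_vec d" if "i < d" for i
    using vs isd[OF that] by auto
  then have vsd [simp]: "dim_vec (vs ! (ixs ! i)) = d" if "i < d" for i
    using that by (metis carrier_vecD)
  have col: "col U i = vs ! (ixs ! i)" if "i < d" for i
    using that by (intro eq_vecI) (simp_all add: U_def)
  have "mat_adjoint U * U = 1\<^sub>m d"
  proof (rule eq_matI)
    fix i j assume "i < dim_row (1\<^sub>m d)" "j < dim_col (1\<^sub>m d)"
    then have ij: "i < d" "j < d" by auto
    have "(mat_adjoint U * U) $$ (i, j) = vs ! (ixs ! j) \<bullet>c vs ! (ixs ! i)"
      using ij vsc by (simp add: cscalar_prod_sum[of _ d] U_def scalar_prod_def lessThan_atLeast0 mult.commute)
    then show "(mat_adjoint U * U) $$ (i, j) = 1\<^sub>m d $$ (i, j)"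
      using on isd ij isi by auto
  qed (use U in auto)
  moreover have "A * U = U * mat_diag d (\<lambda>i. complex_of_real (l (ixs ! i)))"
  proof (rule mat_col_eqI)
    fix j assume "j < dim_col (U * mat_diag d (\<lambda>i. complex_of_real (l (ixs ! i))))"
    then have j: "j < d" by (simp add: mat_diag_def)
    have "col (A * U) j = A *\<^sub>v vs ! (ixs ! j)" by (simp only: col_mult2[OF A U j] col[OF j])
    also have "\<dots> = complex_of_real (l (ixs ! j)) \<cdot>\<^sub>v vs ! (ixs ! j)" using ev isd[OF j] by simp
    also have "\<dots> = col (U * mat_diag d (\<lambda>i. complex_of_real (l (ixs ! i)))) j"
      using j U vsc[OF j] by (intro eq_vecI) (auto simp: mat_diag_mult_right[of _ d d] U_def)
    finally show "col (A * U) j = col (U * mat_diag d (\<lambda>i. complex_of_real (l (ixs ! i)))) j" .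
  qed (use A U in \<open>auto simp: mat_diag_def\<close>)
  then have "A * U * mat_adjoint U = U * mat_diag d (\<lambda>i. complex_of_real (l (ixs ! i))) * mat_adjoint U"
    by simp
  then have "A * (U * mat_adjoint U) = U * mat_diag d (\<lambda>i. complex_of_real (l (ixs ! i))) * mat_adjoint U"
    using A U by (simp add: assoc_mult_mat[of _ d d _ d _ d])
  ultimately have "diagonalizes d A U (\<lambda>i. l (ixs ! i))"
    using U A unitary_right_inverse[OF U] by (simp add: diagonalizes_def)
  moreover have "l (ixs ! j) \<le> l (ixs ! i)" if "i \<le> j" "j < d" for i j
  proof -
    have "sorted (map (\<lambda>i. - l i) ixs)" by (simp add: ixs_def)
    then show ?thesis using that ixs sorted_nth_mono[of "map (\<lambda>i. - l i) ixs" i j] by simp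
  qed
  ultimately show ?thesis using that by blast
qed

lemma proots_linear_factors:
  fixes xs :: "'a :: idom list"
  shows "proots (\<Prod>x\<leftarrow>xs. [:- x, 1:]) = mset xs"
proof (induction xs)
  case (Cons x xs)
  have "(\<Prod>x\<leftarrow>xs. [:- x, 1:]) \<noteq> 0" by (auto simp: prod_list_zero_iff)
  then show ?case using Cons by (simp add: proots_mult del: mult_pCons_left)
qed simp

text \<open>A is similar to the diagonal matrix, whose characteristic polynomial shows its roots
  with multiplicity.\<close>

lemma eigenvalue_vector_diagonalizes:
  assumes "diagonalizes d A U a"
  shows "eigenvalue_vector A = rev (sort (map a [0..<d]))"
proof -
  let ?D = "mat_diag d (\<lambda>i. complex_of_real (a i))"
  have U: "U \<in> carrier_mat d d" "mat_adjoint U * U = 1\<^sub>m d" "A = U * ?D * mat_adjoint U"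
    using assms by (auto simp: diagonalizes_def)
  have "similar_mat_wit A ?D U (mat_adjoint U)"
    using U unitary_right_inverse[OF U(1,2)] diagonalizes_carrier[OF assms]
    by (intro similar_mat_witI[of _ _ d]) auto
  then have "char_poly A = char_poly ?D"
    by (intro char_poly_similar) (auto simp: similar_mat_def)
  also have "\<dots> = (\<Prod>x\<leftarrow>diag_mat ?D. [:- x, 1:])"
    by (rule char_poly_upper_triangular[of _ d]) (auto simp: mat_diag_def)
  also have "diag_mat ?D = map (\<lambda>i. complex_of_real (a i)) [0..<d]"
    by (auto simp: diag_mat_def mat_diag_def)
  finally have "proots (char_poly A) = mset (map (\<lambda>i. complex_of_real (a i)) [0..<d])"
    by (simp only: proots_linear_factors)
  then have "image_mset Re (proots (char_poly A)) = mset (map a [0..<d])"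
    by (simp add: multiset.map_comp comp_def)
  then show ?thesis by (simp add: eigenvalue_vector_def del: mset_map)
qed

lemma eigenvalue_vector_decreasing:
  assumes A: "diagonalizes d A U a" and dec: "\<And>i j. i \<le> j \<Longrightarrow> j < d \<Longrightarrow> a j \<le> a i"
  shows "eigenvalue_vector A = map a [0..<d]"
proof -
  have "sorted (rev (map a [0..<d]))"
    using dec by (auto simp: sorted_rev_iff_nth_mono)
  then have "sort (map a [0..<d]) = rev (map a [0..<d])"
    by (metis mset_rev properties_for_sort)
  then show ?thesis using eigenvalue_vector_diagonalizes[OF A] by simp
qed

lemma hermitian_diagonalizes_eigenvalue_vector:
  assumes A: "A \<in> carrier_mat d d" and herm: "mat_adjoint A = A"
  obtains U where "diagonalizes d A U (\<lambda>i. eigenvalue_vector A ! i)"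
    "length (eigenvalue_vector A) = d"
    "\<And>i j. i \<le> j \<Longrightarrow> j < d \<Longrightarrow> eigenvalue_vector A ! j \<le> eigenvalue_vector A ! i"
proof -
  obtain U a where U: "diagonalizes d A U a" and dec: "\<And>i j. i \<le> j \<Longrightarrow> j < d \<Longrightarrow> a j \<le> a i"
    using hermitian_diagonalizable[OF A herm] by blast
  have ev: "eigenvalue_vector A = map a [0..<d]"
    using eigenvalue_vector_decreasing[OF U] dec by blast
  have "mat_diag d (\<lambda>i. complex_of_real (eigenvalue_vector A ! i)) = mat_diag d (\<lambda>i. complex_of_real (a i))"
    by (auto simp: mat_diag_def ev)
  then have "diagonalizes d A U (\<lambda>i. eigenvalue_vector A ! i)"
    using U by (simp add: diagonalizes_def)
  then show ?thesis
    using that[of U] dec by (simp add: ev)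
qed

text \<open>The definite description is unique: for diagonalizations by U and V, the matrix
  \<open>W = mat_adjoint V * U\<close> intertwines the two diagonals, so its entry (i, j) vanishes
  unless a_j = b_i. Hence W also intertwines the diagonals after f is applied to them.\<close>

lemma mat_fun_diagonalizes:
  assumes A: "diagonalizes d A U a"
  shows "mat_fun f A = U * mat_diag d (\<lambda>i. complex_of_real (f (a i))) * mat_adjoint U"
proof -
  let ?D = "\<lambda>a. mat_diag d (\<lambda>i. complex_of_real (a i))"
  have U: "U \<in> carrier_mat d d" "mat_adjoint U * U = 1\<^sub>m d" "A = U * ?D a * mat_adjoint U"
    using A by (auto simp: diagonalizes_def)
  have UU: "U * mat_adjoint U = 1\<^sub>m d" using unitary_right_inverse U by blast
  have uniq: "V * ?D (\<lambda>i. f (b i)) * mat_adjoint V = U * ?D (\<lambda>i. f (a i)) * mat_adjoint U"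
    if V: "V \<in> carrier_mat d d" "mat_adjoint V * V = 1\<^sub>m d" "A = V * ?D b * mat_adjoint V" for V b
  proof -
    have VV: "V * mat_adjoint V = 1\<^sub>m d" using unitary_right_inverse V by blast
    define W where "W = mat_adjoint V * U"
    have c [simp]: "mat_adjoint V \<in> carrier_mat d d" "mat_adjoint U \<in> carrier_mat d d"
      "U \<in> carrier_mat d d" "V \<in> carrier_mat d d" "W \<in> carrier_mat d d"
      using U V by (auto simp: W_def)
    note assoc = assoc_mult_mat[of _ d d _ d _ d] mult_carrier_mat[of _ d d _ d]
    have cancel: "mat_adjoint V * (V * X) = X" "mat_adjoint U * (U * X) = X"
      "V * (mat_adjoint V * X) = X" "U * (mat_adjoint U * X) = X" if "X \<in> carrier_mat d d" for X
      using that V(2) U(2) UU VV by (simp_all flip: assoc_mult_mat[of _ d d _ d _ d])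
    have "mat_adjoint V * A * U = W * ?D a"
      unfolding U(3) W_def using U(2) by (simp add: assoc right_mult_one_mat[of _ d d])
    moreover have "mat_adjoint V * A * U = ?D b * W"
      unfolding V(3) W_def by (simp add: assoc cancel)
    ultimately have WD: "W * ?D a = ?D b * W" by simp
    have "W * ?D (\<lambda>i. f (a i)) = ?D (\<lambda>i. f (b i)) * W"
    proof (rule eq_matI)
      fix i j assume "i < dim_row (?D (\<lambda>i. f (b i)) * W)" "j < dim_col (?D (\<lambda>i. f (b i)) * W)"
      then have ij: "i < d" "j < d" using carrier_matD[OF c(5)] by (auto simp: mat_diag_def)
      have "W $$ (i, j) * complex_of_real (a j) = complex_of_real (b i) * W $$ (i, j)"
        using arg_cong[OF WD, of "\<lambda>M. M $$ (i, j)"] ij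
        by (simp add: mat_diag_mult_right[of W d d] mat_diag_mult_left[of W d d])
      then have "W $$ (i, j) = 0 \<or> a j = b i" by (simp add: mult.commute)
      then show "(W * ?D (\<lambda>i. f (a i))) $$ (i, j) = (?D (\<lambda>i. f (b i)) * W) $$ (i, j)"
        using ij by (auto simp: mat_diag_mult_right[of W d d] mat_diag_mult_left[of W d d])
    qed (use carrier_matD[OF c(5)] in \<open>auto simp: mat_diag_def\<close>)
    then have "V * (W * ?D (\<lambda>i. f (a i))) * mat_adjoint U = V * (?D (\<lambda>i. f (b i)) * W) * mat_adjoint U"
      by simp
    then show ?thesis
      using UU by (simp add: assoc W_def cancel right_mult_one_mat[of _ d d])
  qed
  have d: "dim_row A = d" using diagonalizes_carrier[OF A] by simp
  show ?thesis
    unfolding mat_fun_def Let_def d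
  proof (rule the_equality)
    show "\<exists>U' a'. U' \<in> carrier_mat d d \<and> mat_adjoint U' * U' = 1\<^sub>m d \<and> A = U' * ?D a' * mat_adjoint U' \<and>
      U * ?D (\<lambda>i. f (a i)) * mat_adjoint U = U' * ?D (\<lambda>i. f (a' i)) * mat_adjoint U'"
      using U by blast
  qed (use uniq in blast)
qed

section \<open>Traces and quadratic forms in an orthonormal eigenbasis\<close>

lemma mat_trace_mat_fun:
  assumes "diagonalizes d A U a"
  shows "Re (mat_trace (mat_fun f A)) = (\<Sum>i<d. f (a i))"
proof -
  have U: "U \<in> carrier_mat d d" "mat_adjoint U * U = 1\<^sub>m d"
    using assms by (auto simp: diagonalizes_def)
  show ?thesis
    unfolding mat_fun_diagonalizes[OF assms] mat_trace_diag_conj[OF U] by simp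
qed

lemma mat_trace_diagonalizes:
  assumes "diagonalizes d A U a"
  shows "Re (mat_trace A) = (\<Sum>i<d. a i)"
proof -
  have U: "U \<in> carrier_mat d d" "mat_adjoint U * U = 1\<^sub>m d"
    "A = U * mat_diag d (\<lambda>i. complex_of_real (a i)) * mat_adjoint U"
    using assms by (auto simp: diagonalizes_def)
  show ?thesis unfolding U(3) mat_trace_diag_conj[OF U(1,2)] by simp
qed

lemma mat_trace_square:
  assumes "diagonalizes d A U a"
  shows "Re (mat_trace (A * A)) = (\<Sum>i<d. (a i)\<^sup>2)"
proof -
  have U: "U \<in> carrier_mat d d" "mat_adjoint U * U = 1\<^sub>m d"
    "A = U * mat_diag d (\<lambda>i. complex_of_real (a i)) * mat_adjoint U"
    using assms by (auto simp: diagonalizes_def)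
  show ?thesis
    unfolding U(3) diag_conj_mult[OF U(1,2)] mat_trace_diag_conj[OF U(1,2)]
    by (simp add: power2_eq_square)
qed

lemma mat_trace_inverse:
  assumes A: "diagonalizes d A U a" and nz: "\<And>i. i < d \<Longrightarrow> a i \<noteq> 0"
  shows "Re (mat_trace (the (mat_inverse A))) = (\<Sum>i<d. 1 / a i)"
proof -
  let ?B = "U * mat_diag d (\<lambda>i. complex_of_real (1 / a i)) * mat_adjoint U"
  have U: "U \<in> carrier_mat d d" "mat_adjoint U * U = 1\<^sub>m d"
    "A = U * mat_diag d (\<lambda>i. complex_of_real (a i)) * mat_adjoint U"
    using A by (auto simp: diagonalizes_def)
  have one: "mat_diag d (\<lambda>i. complex_of_real (1 / a i) * complex_of_real (a i)) = 1\<^sub>m d"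
    "mat_diag d (\<lambda>i. complex_of_real (a i) * complex_of_real (1 / a i)) = 1\<^sub>m d"
    using nz by (auto simp: mat_diag_def)
  have B: "?B \<in> carrier_mat d d" using U by (auto intro!: mult_carrier_mat[of _ d d _ d])
  have BA: "?B * A = 1\<^sub>m d" "A * ?B = 1\<^sub>m d"
    unfolding U(3) diag_conj_mult[OF U(1,2)] one using unitary_right_inverse[OF U(1,2)] U(1) by auto
  have Ac: "A \<in> carrier_mat d d" using diagonalizes_carrier[OF A] .
  \<comment> \<open>Being a unit of the matrix ring excludes the result \<open>None\<close> of
    \<open>mat_inverse\<close>; uniqueness of inverses then identifies the result with the explicit
    one.\<close>
  have "A \<in> Units (ring_mat TYPE(complex) d ())"
    using BA B Ac by (auto simp: Units_def ring_mat_simps)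
  then obtain C where C: "mat_inverse A = Some C"
    using mat_inverse(1)[OF Ac, where b = "()"] by (cases "mat_inverse A") auto
  then have "A * C = 1\<^sub>m d" "C \<in> carrier_mat d d" using mat_inverse(2)[OF Ac] by auto
  then have "?B * A * C = ?B" using B Ac right_mult_one_mat[OF B] by (simp only: assoc_mult_mat[of _ d d _ d _ d])
  then have "C = ?B" unfolding BA using \<open>C \<in> carrier_mat d d\<close> by simp
  then show ?thesis using C mat_trace_diag_conj[OF U(1,2)] by simp
qed

lemma quadratic_form_diagonalizes:
  assumes A: "diagonalizes d A U a" and z: "z \<in> carrier_vec d"
  shows "(A *\<^sub>v z) \<bullet>c z = complex_of_real (\<Sum>i<d. a i * (cmod (z \<bullet>c col U i))\<^sup>2)"
proof -
  let ?D = "mat_diag d (\<lambda>i. complex_of_real (a i))"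
  have U: "U \<in> carrier_mat d d" "A = U * ?D * mat_adjoint U"
    using A by (auto simp: diagonalizes_def)
  define y where "y = mat_adjoint U *\<^sub>v z"
  have U' [simp]: "mat_adjoint U \<in> carrier_mat d d" using U by simp
  have y: "y \<in> carrier_vec d" using z by (auto simp: y_def intro: mult_mat_vec_carrier[of _ d d])
  have yi: "y $ i = z \<bullet>c col U i" if "i < d" for i
    using that U(1) z
    by (simp add: y_def cscalar_prod_sum[of _ d] scalar_prod_def lessThan_atLeast0 mult.commute)
  have Dy: "?D *\<^sub>v y \<in> carrier_vec d" using y by (auto intro: mult_mat_vec_carrier[of _ d d])
  have Dyi: "(?D *\<^sub>v y) $ i = complex_of_real (a i) * y $ i" if "i < d" for i
  proof -
    have "(?D *\<^sub>v y) $ i = (\<Sum>j<d. (if i = j then complex_of_real (a j) else 0) * y $ j)"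
      using that y by (simp add: mat_diag_def scalar_prod_def lessThan_atLeast0)
    also have "\<dots> = (\<Sum>j<d. if i = j then complex_of_real (a j) * y $ j else 0)"
      by (intro sum.cong) auto
    finally show ?thesis using that by simp
  qed
  have "A *\<^sub>v z = U *\<^sub>v (?D *\<^sub>v y)"
    using U(1) z by (simp add: U(2) y_def assoc_mult_mat_vec[of _ d d _ d]
        mult_carrier_mat[of _ d d _ d] mult_mat_vec_carrier[of _ d d])
  then have "(A *\<^sub>v z) \<bullet>c z = (?D *\<^sub>v y) \<bullet>c y"
    using cscalar_prod_adjoint[OF U(1) Dy z] by (simp add: y_def)
  also have "\<dots> = (\<Sum>i<d. complex_of_real (a i) * (y $ i * cnj (y $ i)))"
    using y by (simp add: cscalar_prod_sum[of _ d] Dyi mult_ac)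
  also have "\<dots> = complex_of_real (\<Sum>i<d. a i * (cmod (z \<bullet>c col U i))\<^sup>2)"
    by (simp add: yi flip: complex_norm_square)
  finally show ?thesis .
qed

text \<open>This is the formula for the quadratic form, applied to the identity matrix with all
  eigenvalues 1.\<close>

lemma parseval_unitary:
  assumes U: "U \<in> carrier_mat d d" "mat_adjoint U * U = 1\<^sub>m d" and z: "z \<in> carrier_vec d"
  shows "sqnorm z = (\<Sum>i<d. (cmod (z \<bullet>c col U i))\<^sup>2)"
proof -
  have "mat_diag d (\<lambda>i. complex_of_real 1) = 1\<^sub>m d" by (auto simp: mat_diag_def)
  then have "diagonalizes d (1\<^sub>m d) U (\<lambda>i. 1)"
    using U unitary_right_inverse[OF U] by (simp add: diagonalizes_def)
  from quadratic_form_diagonalizes[OF this z] z show ?thesis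
    by (simp add: sqnorm_def del: of_real_sum)
qed

section \<open>Frame operators and their eigenvalues\<close>

lemma frame_operator_carrier [simp]:
  "set G \<subseteq> carrier_vec d \<Longrightarrow> frame_operator d G \<in> carrier_mat d d"
  unfolding frame_operator_def by (induction G) (auto simp: rank_one_def)

lemma frame_operator_dim [simp]:
  assumes "set G \<subseteq> carrier_vec d"
  shows "dim_row (frame_operator d G) = d" "dim_col (frame_operator d G) = d"
  using frame_operator_carrier[OF assms] by blast+

lemma frame_operator_Cons: "frame_operator d (g # G) = rank_one g g + frame_operator d G"
  by (simp add: frame_operator_def)

lemma frame_operator_index:
  assumes "set G \<subseteq> carrier_vec d" "i < d" "j < d"
  shows "frame_operator d G $$ (i, j) = (\<Sum>g\<leftarrow>G. g $ i * cnj (g $ j))"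
  using assms
proof (induction G)
  case Nil
  then show ?case by (simp add: frame_operator_def)
next
  case (Cons g G)
  then have [simp]: "dim_vec g = d" by auto
  show ?case using Cons by (simp add: frame_operator_Cons rank_one_def)
qed

lemma frame_operator_append:
  assumes "set F \<subseteq> carrier_vec d" "set G \<subseteq> carrier_vec d"
  shows "frame_operator d (F @ G) = frame_operator d F + frame_operator d G"
proof (rule eq_matI)
  show "dim_row (frame_operator d (F @ G)) = dim_row (frame_operator d F + frame_operator d G)"
    "dim_col (frame_operator d (F @ G)) = dim_col (frame_operator d F + frame_operator d G)"
    using assms by auto
  fix i j
  assume "i < dim_row (frame_operator d F + frame_operator d G)"
    "j < dim_col (frame_operator d F + frame_operator d G)"
  then have "i < d" "j < d" using assms by auto
  then show "frame_operator d (F @ G) $$ (i, j) = (frame_operator d F + frame_operator d G) $$ (i, j)"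
    using assms frame_operator_index[of "F @ G" d i j] by (simp add: frame_operator_index)
qed

lemma frame_operator_mset:
  assumes "mset F = mset G" "set F \<subseteq> carrier_vec d"
  shows "frame_operator d F = frame_operator d G"
proof (rule eq_matI)
  have G: "set G \<subseteq> carrier_vec d" using assms mset_eq_setD by metis
  show "dim_row (frame_operator d F) = dim_row (frame_operator d G)"
    "dim_col (frame_operator d F) = dim_col (frame_operator d G)"
    using assms G by auto
  fix i j
  assume "i < dim_row (frame_operator d G)" "j < dim_col (frame_operator d G)"
  then have "i < d" "j < d" using G by auto
  moreover have "mset (map (\<lambda>g. g $ i * cnj (g $ j)) F) = mset (map (\<lambda>g. g $ i * cnj (g $ j)) G)"
    using assms(1) by simp
  then have "(\<Sum>g\<leftarrow>F. g $ i * cnj (g $ j)) = (\<Sum>g\<leftarrow>G. g $ i * cnj (g $ j))"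
    by (metis sum_mset_sum_list)
  ultimately show "frame_operator d F $$ (i, j) = frame_operator d G $$ (i, j)"
    using assms(2) G by (simp add: frame_operator_index)
qed

lemma frame_operator_hermitian:
  assumes "set F \<subseteq> carrier_vec d"
  shows "mat_adjoint (frame_operator d F) = frame_operator d F"
proof (rule eq_matI)
  show "dim_row (mat_adjoint (frame_operator d F)) = dim_row (frame_operator d F)"
    "dim_col (mat_adjoint (frame_operator d F)) = dim_col (frame_operator d F)"
    using assms by auto
  fix i j
  assume "i < dim_row (frame_operator d F)" "j < dim_col (frame_operator d F)"
  then have ij: "i < d" "j < d" using assms by auto
  have "cnj (\<Sum>g\<leftarrow>F. g $ j * cnj (g $ i)) = (\<Sum>g\<leftarrow>F. g $ i * cnj (g $ j))"
    by (induction F) (simp_all add: mult.commute)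
  then show "mat_adjoint (frame_operator d F) $$ (i, j) = frame_operator d F $$ (i, j)"
    using ij assms by (simp add: frame_operator_index)
qed

lemma frame_operator_Cons_mult_vec:
  assumes "g \<in> carrier_vec d" "set G \<subseteq> carrier_vec d" "z \<in> carrier_vec d"
  shows "frame_operator d (g # G) *\<^sub>v z = (z \<bullet>c g) \<cdot>\<^sub>v g + frame_operator d G *\<^sub>v z"
proof -
  have "rank_one g g \<in> carrier_mat d d" using assms by (auto simp: rank_one_def)
  then show ?thesis
    using assms rank_one_mult_vec[of z g g]
    by (simp add: frame_operator_Cons add_mult_distrib_mat_vec[of _ d d])
qed

lemma frame_operator_quadratic_form:
  assumes "set G \<subseteq> carrier_vec d" "z \<in> carrier_vec d"
  shows "(frame_operator d G *\<^sub>v z) \<bullet>c z = complex_of_real (\<Sum>g\<leftarrow>G. (cmod (z \<bullet>c g))\<^sup>2)"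
  using assms
proof (induction G)
  case Nil
  then have "0\<^sub>m d d *\<^sub>v z = 0\<^sub>v d" by auto
  then show ?case using Nil by (simp add: frame_operator_def)
next
  case (Cons g G)
  then have c: "frame_operator d G *\<^sub>v z \<in> carrier_vec d" "g \<in> carrier_vec d"
    by (auto intro: mult_mat_vec_carrier[of _ d d])
  have "(frame_operator d (g # G) *\<^sub>v z) \<bullet>c z = (z \<bullet>c g) * (g \<bullet>c z) + (frame_operator d G *\<^sub>v z) \<bullet>c z"
    using Cons.prems c by (simp add: frame_operator_Cons_mult_vec cscalar_prod_add_left[of _ d])
  also have "g \<bullet>c z = cnj (z \<bullet>c g)" using cscalar_prod_swap[of z d g] Cons.prems by auto
  finally show ?case using Cons by (simp flip: complex_norm_square)
qed

lemma frame_operator_trace: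
  assumes "set G \<subseteq> carrier_vec d"
  shows "Re (mat_trace (frame_operator d G)) = (\<Sum>g\<leftarrow>G. sqnorm g)"
proof -
  have "mat_trace (frame_operator d G) = (\<Sum>i<d. \<Sum>g\<leftarrow>G. g $ i * cnj (g $ i))"
    using assms by (simp add: mat_trace_def frame_operator_index)
  also have "\<dots> = (\<Sum>g\<leftarrow>G. \<Sum>i<d. g $ i * cnj (g $ i))"
    by (induction G) (simp_all add: sum.distrib)
  also have "\<dots> = (\<Sum>g\<leftarrow>G. g \<bullet>c g)"
    using assms by (intro arg_cong[of _ _ sum_list] map_cong refl) (auto simp: cscalar_prod_sum[of _ d])
  finally have "Re (mat_trace (frame_operator d G)) = Re (\<Sum>g\<leftarrow>G. g \<bullet>c g)" by simp
  also have "\<dots> = (\<Sum>g\<leftarrow>G. sqnorm g)" by (induction G) (simp_all add: sqnorm_def)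
  finally show ?thesis .
qed

text \<open>A common generalization of the Weyl inequalities: the p + 1 leading eigenvectors of T, the
  d - q trailing ones of S and the orthogonal complement of ws have a nonzero vector in common.\<close>

lemma weyl_inequality:
  assumes S: "diagonalizes d S U a" "\<And>i j. i \<le> j \<Longrightarrow> j < d \<Longrightarrow> a j \<le> a i"
    and T: "diagonalizes d T V x" "\<And>i j. i \<le> j \<Longrightarrow> j < d \<Longrightarrow> x j \<le> x i"
    and ws: "set ws \<subseteq> carrier_vec d" and pq: "p < d" "length ws + q \<le> p"
    and le: "\<And>z. z \<in> carrier_vec d \<Longrightarrow> \<forall>w\<in>set ws. z \<bullet>c w = 0 \<Longrightarrow>
      Re ((T *\<^sub>v z) \<bullet>c z) \<le> Re ((S *\<^sub>v z) \<bullet>c z)"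
  shows "x p \<le> a q"
proof -
  have U: "U \<in> carrier_mat d d" "mat_adjoint U * U = 1\<^sub>m d" using S by (auto simp: diagonalizes_def)
  have V: "V \<in> carrier_mat d d" "mat_adjoint V * V = 1\<^sub>m d" using T by (auto simp: diagonalizes_def)
  \<comment> \<open>These are \<open>length ws\<close> + (d - 1 - p) + q vectors, fewer than d, so
    some nonzero z is orthogonal to all of them. Only the eigenvalues x_0, ..., x_p of T and a_q,
    ..., a_(d-1) of S then contribute to the forms at z.\<close>
  define cs where "cs = ws @ map (col V) [Suc p..<d] @ map (col U) [0..<q]"
  have "set cs \<subseteq> carrier_vec d" using ws U V by (auto simp: cs_def)
  moreover have "length cs < d" using pq by (simp add: cs_def)
  ultimately obtain z where z: "z \<in> carrier_vec d" "z \<noteq> 0\<^sub>v d" "\<forall>w\<in>set cs. z \<bullet>c w = 0"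
    using ex_orthogonal_vec by blast
  have zU: "z \<bullet>c col U i = 0" if "i < q" for i using z that by (auto simp: cs_def)
  have zV: "z \<bullet>c col V i = 0" if "p < i" "i < d" for i using z that by (auto simp: cs_def)
  have "x p * sqnorm z = (\<Sum>i<d. x p * (cmod (z \<bullet>c col V i))\<^sup>2)"
    by (simp add: parseval_unitary[OF V z(1)] sum_distrib_left)
  also have "\<dots> \<le> (\<Sum>i<d. x i * (cmod (z \<bullet>c col V i))\<^sup>2)"
  proof (rule sum_mono)
    fix i assume "i \<in> {..<d}"
    then show "x p * (cmod (z \<bullet>c col V i))\<^sup>2 \<le> x i * (cmod (z \<bullet>c col V i))\<^sup>2"
      using zV[of i] T(2)[of i p] pq by (cases "p < i") (auto intro: mult_right_mono)
  qed
  also have "\<dots> \<le> (\<Sum>i<d. a i * (cmod (z \<bullet>c col U i))\<^sup>2)"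
    using le[OF z(1)] z(3)
    by (simp add: cs_def quadratic_form_diagonalizes[OF S(1) z(1)] quadratic_form_diagonalizes[OF T(1) z(1)] del: of_real_sum)
  also have "\<dots> \<le> (\<Sum>i<d. a q * (cmod (z \<bullet>c col U i))\<^sup>2)"
  proof (rule sum_mono)
    fix i assume "i \<in> {..<d}"
    then show "a i * (cmod (z \<bullet>c col U i))\<^sup>2 \<le> a q * (cmod (z \<bullet>c col U i))\<^sup>2"
      using zU[of i] S(2)[of q i] by (cases "i < q") (auto intro: mult_right_mono)
  qed
  also have "\<dots> = a q * sqnorm z"
    by (simp add: parseval_unitary[OF U z(1)] sum_distrib_left)
  finally show ?thesis
    using z sqnorm_nonneg[of z] sqnorm_eq_0_iff[of z] by (auto simp: mult_le_cancel_right)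
qed

lemma frame_operator_diagonalizes:
  assumes "set F \<subseteq> carrier_vec d"
  obtains U where "diagonalizes d (frame_operator d F) U (\<lambda>i. eigenvalue_vector (frame_operator d F) ! i)"
  using hermitian_diagonalizes_eigenvalue_vector[OF frame_operator_carrier[OF assms]
      frame_operator_hermitian[OF assms]] by metis

lemma frame_operator_eigenvalue_vector:
  assumes "set F \<subseteq> carrier_vec d"
  shows "length (eigenvalue_vector (frame_operator d F)) = d"
    "\<And>i j. i \<le> j \<Longrightarrow> j < d \<Longrightarrow>
      eigenvalue_vector (frame_operator d F) ! j \<le> eigenvalue_vector (frame_operator d F) ! i"
  using hermitian_diagonalizes_eigenvalue_vector[OF frame_operator_carrier[OF assms]
      frame_operator_hermitian[OF assms]] by metis+

text \<open>Appending vectors adds a nonnegative quadratic form, so the Weyl inequality applies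
  without constraints and with p = q = i.\<close>

lemma frame_operator_eigenvalues_append_ge:
  assumes "set F \<subseteq> carrier_vec d" "set G \<subseteq> carrier_vec d" "i < d"
  shows "eigenvalue_vector (frame_operator d F) ! i \<le> eigenvalue_vector (frame_operator d (F @ G)) ! i"
proof -
  have FG: "set (F @ G) \<subseteq> carrier_vec d" using assms by simp
  obtain U where U: "diagonalizes d (frame_operator d F) U (\<lambda>i. eigenvalue_vector (frame_operator d F) ! i)"
    by (rule frame_operator_diagonalizes[OF assms(1)])
  obtain V where V: "diagonalizes d (frame_operator d (F @ G)) V (\<lambda>i. eigenvalue_vector (frame_operator d (F @ G)) ! i)"
    by (rule frame_operator_diagonalizes[OF FG])
  show ?thesis
  proof (rule weyl_inequality[OF V frame_operator_eigenvalue_vector(2)[OF FG]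
        U frame_operator_eigenvalue_vector(2)[OF assms(1)], where ws = "[]"])
    fix z :: "complex vec" assume z: "z \<in> carrier_vec d"
    have "0 \<le> (\<Sum>g\<leftarrow>G. (cmod (z \<bullet>c g))\<^sup>2)" by (rule sum_list_nonneg) auto
    then show "Re ((frame_operator d F *\<^sub>v z) \<bullet>c z) \<le> Re ((frame_operator d (F @ G) *\<^sub>v z) \<bullet>c z)"
      using z assms FG by (simp add: frame_operator_quadratic_form del: set_append)
  qed (use assms in auto)
qed

text \<open>On the orthogonal complement of G both quadratic forms agree. Taking G as the list of
  constraints costs \<open>length G\<close> places.\<close>

lemma frame_operator_eigenvalues_append_le:
  assumes "set F \<subseteq> carrier_vec d" "set G \<subseteq> carrier_vec d" "i + length G < d"
  shows "eigenvalue_vector (frame_operator d (F @ G)) ! (i + length G) \<le> eigenvalue_vector (frame_operator d F) ! i"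
proof -
  have FG: "set (F @ G) \<subseteq> carrier_vec d" using assms by simp
  obtain U where U: "diagonalizes d (frame_operator d F) U (\<lambda>i. eigenvalue_vector (frame_operator d F) ! i)"
    by (rule frame_operator_diagonalizes[OF assms(1)])
  obtain V where V: "diagonalizes d (frame_operator d (F @ G)) V (\<lambda>i. eigenvalue_vector (frame_operator d (F @ G)) ! i)"
    by (rule frame_operator_diagonalizes[OF FG])
  show ?thesis
  proof (rule weyl_inequality[OF U frame_operator_eigenvalue_vector(2)[OF assms(1)]
        V frame_operator_eigenvalue_vector(2)[OF FG], where ws = G])
    fix z :: "complex vec" assume z: "z \<in> carrier_vec d" "\<forall>g\<in>set G. z \<bullet>c g = 0"
    then have "(\<Sum>g\<leftarrow>G. (cmod (z \<bullet>c g))\<^sup>2) = 0" by (induction G) auto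
    then show "Re ((frame_operator d (F @ G) *\<^sub>v z) \<bullet>c z) \<le> Re ((frame_operator d F *\<^sub>v z) \<bullet>c z)"
      using z assms FG by (simp add: frame_operator_quadratic_form del: set_append)
  qed (use assms in auto)
qed

section \<open>Positivity, spanning and rank in terms of the spectrum\<close>

lemma cscalar_prod_col_unitary:
  fixes U :: "complex mat"
  assumes U: "U \<in> carrier_mat d d" "mat_adjoint U * U = 1\<^sub>m d" and ij: "i < d" "j < d"
  shows "col U i \<bullet>c col U j = (if i = j then 1 else 0)"
proof -
  have "col U i \<bullet>c col U j = (mat_adjoint U * U) $$ (j, i)"
    using U(1) ij by (simp add: cscalar_prod_sum[of _ d] scalar_prod_def lessThan_atLeast0 mult.commute)
  then show ?thesis using U(2) ij by auto
qed

text \<open>Both sides are the value of the quadratic form at the unit eigenvector.\<close>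

lemma frame_operator_eigenvalue_eq:
  assumes F: "set F \<subseteq> carrier_vec d" and S: "diagonalizes d (frame_operator d F) U a" and i: "i < d"
  shows "a i = (\<Sum>g\<leftarrow>F. (cmod (col U i \<bullet>c g))\<^sup>2)"
proof -
  have U: "U \<in> carrier_mat d d" "mat_adjoint U * U = 1\<^sub>m d" using S by (auto simp: diagonalizes_def)
  have c: "col U i \<in> carrier_vec d" using U i by auto
  have "(\<Sum>g\<leftarrow>F. (cmod (col U i \<bullet>c g))\<^sup>2) = (\<Sum>j<d. a j * (cmod (col U i \<bullet>c col U j))\<^sup>2)"
    using frame_operator_quadratic_form[OF F c] quadratic_form_diagonalizes[OF S c]
    by (simp del: of_real_sum)
  also have "\<dots> = (\<Sum>j<d. if i = j then a j else 0)"
    using cscalar_prod_col_unitary[OF U i] by (intro sum.cong) auto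
  also have "\<dots> = a i" using i by simp
  finally show ?thesis by simp
qed

lemma frame_operator_eigenvalue_nonneg:
  assumes "set F \<subseteq> carrier_vec d" "diagonalizes d (frame_operator d F) U a" "i < d"
  shows "a i \<ge> 0"
  using frame_operator_eigenvalue_eq[OF assms] by (auto intro!: sum_list_nonneg)

text \<open>An eigenvector for the eigenvalue 0 would be orthogonal to every frame vector, hence to
  their span, hence to itself.\<close>

lemma frame_eigenvalue_pos:
  assumes F: "F \<in> frames n d" and S: "diagonalizes d (frame_operator d F) U a" and i: "i < d"
  shows "a i > 0"
proof (rule ccontr)
  assume "\<not> a i > 0"
  interpret vec_space "TYPE(complex)" d .
  have Fc: "set F \<subseteq> carrier_vec d" and span: "span (set F) = carrier_vec d"
    using F by (auto simp: frames_def)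
  have U: "U \<in> carrier_mat d d" "mat_adjoint U * U = 1\<^sub>m d" using S by (auto simp: diagonalizes_def)
  have c: "col U i \<in> carrier_vec d" using U i by auto
  have "(\<Sum>g\<leftarrow>F. (cmod (col U i \<bullet>c g))\<^sup>2) = 0"
    using frame_operator_eigenvalue_eq[OF Fc S i] frame_operator_eigenvalue_nonneg[OF Fc S i] \<open>\<not> a i > 0\<close>
    by simp
  then have "\<forall>g\<in>set F. col U i \<bullet>c g = 0"
    by (subst (asm) sum_list_nonneg_eq_0_iff) auto
  then have "g \<bullet> conjugate (col U i) = 0" if "g \<in> set F" for g
    using that Fc cscalar_prod_swap[OF c, of g] by auto
  \<comment> \<open>\<open>orthogonal_complement\<close> refers to the bilinear product, so the
    conjugate of the eigenvector is the element to consider.\<close>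
  then have "conjugate (col U i) \<in> orthogonal_complement (set F)"
    using Fc c by (auto simp: orthogonal_complement_def comm_scalar_prod[of _ d])
  then have "conjugate (col U i) \<in> orthogonal_complement (span (set F))"
    using in_orthogonal_complement_span[OF Fc] by simp
  then have "conjugate (col U i) \<bullet> col U i = 0"
    using c unfolding span by (auto simp: orthogonal_complement_def)
  then have "col U i \<bullet>c col U i = 0" using c by (simp add: comm_scalar_prod[of _ d])
  then show False using cscalar_prod_col_unitary[OF U i i] by simp
qed

text \<open>G is separated from F so that the span stays fixed while the induction runs over
  G.\<close>

lemma frame_operator_mult_vec_span:
  assumes "set G \<subseteq> set F" "set F \<subseteq> carrier_vec d" "z \<in> carrier_vec d"
  shows "frame_operator d G *\<^sub>v z \<in> LinearCombinations.module.span class_ring (module_vec TYPE(complex) d) (set F)"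
  using assms(1)
proof (induction G)
  interpret vec_space "TYPE(complex)" d .
  case Nil
  have "frame_operator d [] *\<^sub>v z = 0\<^sub>v d" using assms by (auto simp: frame_operator_def)
  also have "\<dots> = lincomb (\<lambda>_. 0) {}" by (simp add: lincomb_def)
  also have "\<dots> \<in> span (set F)" by (auto simp: span_def intro!: exI[of _ "\<lambda>_. 0"] exI[of _ "{}"])
  finally show ?case .
next
  interpret vec_space "TYPE(complex)" d .
  case (Cons g G)
  then have "set G \<subseteq> carrier_vec d" "g \<in> carrier_vec d" using assms by auto
  moreover have "(z \<bullet>c g) \<cdot>\<^sub>v g \<in> span (set F)"
    using assms Cons.prems by (intro smult_in_span span_mem) auto
  ultimately show ?case
    using Cons assms span_add1[of "set F"] by (simp add: frame_operator_Cons_mult_vec)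
qed

text \<open>The frame operator is invertible, and each of its values is a combination of the vectors
  of F.\<close>

lemma framesI:
  assumes F: "set F \<subseteq> carrier_vec d" "length F = n"
    and S: "diagonalizes d (frame_operator d F) U a" and pos: "\<And>i. i < d \<Longrightarrow> a i > 0"
  shows "F \<in> frames n d"
proof -
  interpret vec_space "TYPE(complex)" d .
  let ?B = "U * mat_diag d (\<lambda>i. complex_of_real (1 / a i)) * mat_adjoint U"
  have U: "U \<in> carrier_mat d d" "mat_adjoint U * U = 1\<^sub>m d"
    "frame_operator d F = U * mat_diag d (\<lambda>i. complex_of_real (a i)) * mat_adjoint U"
    using S by (auto simp: diagonalizes_def)
  have B: "?B \<in> carrier_mat d d" using U by (auto intro!: mult_carrier_mat[of _ d d _ d])
  have nz: "a i \<noteq> 0" if "i < d" for i using pos[OF that] by simp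
  have "mat_diag d (\<lambda>i. complex_of_real (a i) * complex_of_real (1 / a i)) = 1\<^sub>m d"
    by (intro eq_matI) (auto simp: mat_diag_def nz)
  then have inv: "frame_operator d F * ?B = 1\<^sub>m d"
    unfolding U(3) diag_conj_mult[OF U(1,2)] using unitary_right_inverse[OF U(1,2)] U(1) by auto
  have "z \<in> span (set F)" if z: "z \<in> carrier_vec d" for z
  proof -
    have "z = frame_operator d F *\<^sub>v (?B *\<^sub>v z)"
      using inv z assoc_mult_mat_vec[OF frame_operator_carrier[OF F(1)] B z] by simp
    then show ?thesis
      using frame_operator_mult_vec_span[OF order_refl F(1) mult_mat_vec_carrier[OF B z]] by simp
  qed
  then show ?thesis using F span_closed by (auto simp: frames_def)
qed

lemma (in vec_space) rank_sum_product_entries: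
  "rank (mat n nc (\<lambda>(i, j). \<Sum>l<(p :: nat). f l i * g l j)) \<le> p"
proof (induction p)
  case 0
  have "mat n nc (\<lambda>(i, j). \<Sum>l<(0 :: nat). f l i * g l j) = 0\<^sub>m n nc" by auto
  then show ?case by (simp only: rank_0I)
next
  case (Suc p)
  let ?A = "mat n nc (\<lambda>(i, j). \<Sum>l<p. f l i * g l j)" and ?B = "mat n nc (\<lambda>(i, j). f p i * g p j)"
  have "rank ?B \<le> 1" by (rule rank_le_1_product_entries[of _ nc "f p" "g p"]) auto
  moreover have "mat n nc (\<lambda>(i, j). \<Sum>l<Suc p. f l i * g l j) = ?A + ?B" by auto
  moreover have "rank (?A + ?B) \<le> rank ?A + rank ?B" by (rule rank_subadditive[of _ nc]) auto
  ultimately show ?case using Suc by simp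
qed

text \<open>S is a sum of p matrices of rank at most 1. In contrapositive form this turns a lower
  bound on the rank into positivity of leading eigenvalues.\<close>

lemma diagonalizes_rank_le:
  assumes S: "diagonalizes d S U a" and p: "p \<le> d" and z: "\<And>i. p \<le> i \<Longrightarrow> i < d \<Longrightarrow> a i = 0"
  shows "vec_space.rank d S \<le> p"
proof -
  have U: "U \<in> carrier_mat d d" "S = U * mat_diag d (\<lambda>i. complex_of_real (a i)) * mat_adjoint U"
    using S by (auto simp: diagonalizes_def)
  have "S = mat d d (\<lambda>(i, j). \<Sum>l<p. U $$ (i, l) * (complex_of_real (a l) * cnj (U $$ (j, l))))"
  proof (rule eq_matI)
    fix i j assume "i < dim_row (mat d d (\<lambda>(i, j). \<Sum>l<p. U $$ (i, l) * (complex_of_real (a l) * cnj (U $$ (j, l)))))"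
      "j < dim_col (mat d d (\<lambda>(i, j). \<Sum>l<p. U $$ (i, l) * (complex_of_real (a l) * cnj (U $$ (j, l)))))"
    then have ij: "i < d" "j < d" by auto
    have "S $$ (i, j) = (\<Sum>l<d. U $$ (i, l) * complex_of_real (a l) * cnj (U $$ (j, l)))"
      unfolding U(2) by (rule diag_conj_index[OF U(1) ij])
    also have "\<dots> = (\<Sum>l<p. U $$ (i, l) * complex_of_real (a l) * cnj (U $$ (j, l)))"
      using p z by (intro sum.mono_neutral_right) auto
    finally show "S $$ (i, j) = mat d d (\<lambda>(i, j). \<Sum>l<p. U $$ (i, l) * (complex_of_real (a l) * cnj (U $$ (j, l)))) $$ (i, j)"
      using ij by (simp add: mult.assoc)
  qed (use diagonalizes_carrier[OF S] in auto)
  then show ?thesis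
    using vec_space.rank_sum_product_entries[of d d "\<lambda>l i. U $$ (i, l)" "\<lambda>l j. complex_of_real (a l) * cnj (U $$ (j, l))" p]
    by simp
qed

section \<open>Sums of convex functions\<close>

lemma between_convex_combination:
  fixes c x v :: real
  assumes "v \<in> {min c x..max c x}"
  shows "\<exists>u. 0 \<le> u \<and> u \<le> 1 \<and> v = (1 - u) * c + u * x"
proof (cases "c = x")
  case True
  then show ?thesis using assms by (intro exI[of _ 0]) auto
next
  case False
  let ?u = "(v - c) / (x - c)"
  have "0 \<le> ?u" "?u \<le> 1"
    using assms False by (cases "c < x"; simp add: divide_simps)+
  moreover have "?u * (x - c) = v - c" using False by simp
  then have "v = (1 - ?u) * c + ?u * x" by (simp only: left_diff_distrib right_diff_distrib)
  ultimately show ?thesis by blast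
qed

lemma convex_between_le:
  fixes g :: "real \<Rightarrow> real"
  assumes g: "convex_on A g" and cx: "c \<in> A" "x \<in> A" and v: "v \<in> {min c x..max c x}"
    and min: "g c \<le> g x"
  shows "g v \<le> g x"
proof -
  obtain u where u: "0 \<le> u" "u \<le> 1" "v = (1 - u) * c + u * x"
    using between_convex_combination[OF v] by blast
  have "g v \<le> (1 - u) * g c + u * g x"
    using convex_onD[OF g u(1,2) cx] by (simp add: u(3))
  also have "\<dots> \<le> (1 - u) * g x + u * g x"
    using u min by (intro add_right_mono mult_left_mono) auto
  finally show ?thesis by (simp add: algebra_simps)
qed

lemma strictly_convex_on_imp_convex_on:
  assumes "strictly_convex_on A f"
  shows "convex_on A f"
proof (rule convex_onI)
  show "convex A" using assms by (simp add: strictly_convex_on_def)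
  fix t x y :: real assume t: "0 < t" "t < 1" "x \<in> A" "y \<in> A"
  show "f ((1 - t) *\<^sub>R x + t *\<^sub>R y) \<le> (1 - t) * f x + t * f y"
  proof (cases "x = y")
    case True
    then show ?thesis by (simp add: algebra_simps)
  next
    case False
    then have "f ((1 - t) * x + (1 - (1 - t)) * y) < (1 - t) * f x + (1 - (1 - t)) * f y"
      using assms t unfolding strictly_convex_on_def by (metis diff_gt_0_iff_gt diff_less_eq less_add_same_cancel1)
    then show ?thesis by simp
  qed
qed

lemma strictly_convex_on_subset:
  assumes "strictly_convex_on A f" "B \<subseteq> A" "convex B"
  shows "strictly_convex_on B f"
  using assms by (auto simp: strictly_convex_on_def subset_iff)

lemma strictly_convex_between_less:
  fixes g :: "real \<Rightarrow> real"
  assumes g: "strictly_convex_on A g" and cx: "c \<in> A" "x \<in> A" and v: "v \<in> {min c x..max c x}"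
    and min: "\<And>y. y \<in> A \<Longrightarrow> g c \<le> g y" and ne: "v \<noteq> x"
  shows "g v < g x"
proof -
  obtain u where u: "0 \<le> u" "u \<le> 1" "v = (1 - u) * c + u * x"
    using between_convex_combination[OF v] by blast
  have "u \<noteq> 1" using u ne by auto
  then have "u < 1" using u by simp
  have "c \<noteq> x" using u ne by (auto simp: algebra_simps)
  note ne' = \<open>u < 1\<close> \<open>c \<noteq> x\<close>
  have A: "convex A" and strict: "\<And>x y u. x \<in> A \<Longrightarrow> y \<in> A \<Longrightarrow> x \<noteq> y \<Longrightarrow> 0 < u \<Longrightarrow> u < 1 \<Longrightarrow>
      g (u * x + (1 - u) * y) < u * g x + (1 - u) * g y"
    using g by (auto simp: strictly_convex_on_def)
  \<comment> \<open>By strict convexity at the midpoint, the minimum at c is attained nowhere else,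
    so g c < g x.\<close>
  have "(1 / 2) *\<^sub>R c + (1 / 2) *\<^sub>R x \<in> A" using cx by (intro convexD[OF A]) auto
  then have "g c \<le> g (1 / 2 * c + (1 - 1 / 2) * x)" using min[of "1 / 2 * c + (1 - 1 / 2) * x"] by simp
  also have "\<dots> < 1 / 2 * g c + (1 - 1 / 2) * g x" using cx ne' by (intro strict) auto
  finally have lt: "g c < g x" by simp
  have "g v \<le> (1 - u) * g c + u * g x"
    using convex_onD[OF strictly_convex_on_imp_convex_on[OF g] u(1,2) cx] by (simp add: u(3))
  also have "\<dots> < (1 - u) * g x + u * g x" using lt ne' by simp
  finally show ?thesis by (simp add: algebra_simps)
qed

lemma convex_on_add_linear:
  fixes f :: "real \<Rightarrow> real"
  assumes "convex_on A f"
  shows "convex_on A (\<lambda>y. f y + s * y)"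
proof (rule convex_on_add[OF assms])
  show "convex_on A (\<lambda>y. s * y)"
    using assms by (intro convex_onI) (auto simp: convex_on_def algebra_simps)
qed

lemma strictly_convex_on_add_linear:
  fixes f :: "real \<Rightarrow> real"
  assumes "strictly_convex_on A f"
  shows "strictly_convex_on A (\<lambda>y. f y + s * y)"
  unfolding strictly_convex_on_def
proof (intro conjI ballI allI impI)
  show "convex A" using assms by (simp add: strictly_convex_on_def)
  fix x y u :: real assume "x \<in> A" "y \<in> A" "x \<noteq> y" "0 < u" "u < 1"
  then have "f (u * x + (1 - u) * y) < u * f x + (1 - u) * f y"
    using assms by (simp add: strictly_convex_on_def)
  then show "f (u * x + (1 - u) * y) + s * (u * x + (1 - u) * y) < u * (f x + s * x) + (1 - u) * (f y + s * y)"
    by (simp add: algebra_simps)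
qed

text \<open>The supporting slope at c is the supremum of the slopes of secants to the left of c; by
  convexity every secant slope to the right bounds it from above. Its negative is s, so that c
  minimizes f y + s * y on the positive reals.\<close>

lemma ex_subgradient:
  fixes f :: "real \<Rightarrow> real"
  assumes "convex_on {0<..} f" "c > 0"
  obtains s where "\<And>y. y > 0 \<Longrightarrow> f c + s * c \<le> f y + s * y"
proof -
  define L where "L = (\<lambda>x. (f c - f x) / (c - x)) ` {0<..<c}"
  have slope: "(f c - f x) / (c - x) \<le> (f y - f c) / (y - c)" if "0 < x" "x < c" "c < y" for x y
  proof -
    have "(f x - f c) / (x - c) \<le> (f x - f y) / (x - y)" "(f x - f y) / (x - y) \<le> (f c - f y) / (c - y)"
      using convex_on_slope_le[OF assms(1) _ _ that(2,3)] that by auto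
    then have "(f x - f c) / (x - c) \<le> (f c - f y) / (c - y)" by linarith
    then show ?thesis by (metis minus_diff_eq minus_divide_divide)
  qed
  have ne: "L \<noteq> {}" using assms(2) by (auto simp: L_def)
  have bdd: "bdd_above L"
    \<comment> \<open>The bound is the slope of the secant from c to c + 1.\<close>
    using slope[of _ "c + 1"] by (intro bdd_aboveI[of _ "f (c + 1) - f c"]) (auto simp: L_def)
  have "f c + Sup L * (y - c) \<le> f y" if y: "y > 0" for y
  proof (cases y c rule: linorder_cases)
    case less
    then have "(f c - f y) / (c - y) \<le> Sup L"
      using y by (intro cSup_upper bdd) (auto simp: L_def)
    then show ?thesis using less by (simp add: pos_divide_le_eq algebra_simps)
  next
    case greater
    have "Sup L \<le> (f y - f c) / (y - c)"
      using slope[OF _ _ greater] by (intro cSup_least ne) (auto simp: L_def)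
    then show ?thesis using greater by (simp add: pos_le_divide_eq algebra_simps)
  qed simp
  then show ?thesis using that[of "- Sup L"] by (simp add: algebra_simps)
qed

text \<open>Subtracting a linear function from f turns c into a minimum point without changing the
  difference of the two sums; then each entry may be compared separately.\<close>

lemma convex_sum_le:
  fixes f :: "real \<Rightarrow> real" and \<nu> x :: "nat \<Rightarrow> real"
  assumes f: "convex_on {0<..} f" and c: "c > 0"
    and x: "\<And>i. i < d \<Longrightarrow> x i > 0" and seg: "\<And>i. i < d \<Longrightarrow> \<nu> i \<in> {min c (x i)..max c (x i)}"
    and sum: "(\<Sum>i<d. \<nu> i) = (\<Sum>i<d. x i)"
  shows "(\<Sum>i<d. f (\<nu> i)) \<le> (\<Sum>i<d. f (x i))"
proof -
  obtain s where s: "\<And>y. y > 0 \<Longrightarrow> f c + s * c \<le> f y + s * y"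
    using ex_subgradient[OF f c] by blast
  have "(\<Sum>i<d. f (\<nu> i) + s * \<nu> i) \<le> (\<Sum>i<d. f (x i) + s * x i)"
  proof (rule sum_mono)
    fix i assume "i \<in> {..<d}"
    then show "f (\<nu> i) + s * \<nu> i \<le> f (x i) + s * x i"
      using convex_between_le[OF convex_on_add_linear[OF f], of c "x i" "\<nu> i" s] s[of "x i"] c x seg
      by simp
  qed
  then show ?thesis using sum by (simp add: sum.distrib flip: sum_distrib_left)
qed

text \<open>The equality case of the preceding comparison: after the same tilt no term increases,
  and a single index with \<nu> i different from x i would make the inequality of the sums
  strict.\<close>

lemma strictly_convex_sum_eqD:
  fixes f :: "real \<Rightarrow> real" and \<nu> x :: "nat \<Rightarrow> real"
  assumes f: "strictly_convex_on {0<..} f" and c: "c > 0"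
    and x: "\<And>i. i < d \<Longrightarrow> x i > 0" and seg: "\<And>i. i < d \<Longrightarrow> \<nu> i \<in> {min c (x i)..max c (x i)}"
    and sum: "(\<Sum>i<d. \<nu> i) = (\<Sum>i<d. x i)"
    and eq: "(\<Sum>i<d. f (x i)) \<le> (\<Sum>i<d. f (\<nu> i))" and i: "i < d"
  shows "\<nu> i = x i"
proof (rule ccontr)
  assume ne: "\<nu> i \<noteq> x i"
  have f': "convex_on {0<..} f" by (rule strictly_convex_on_imp_convex_on[OF f])
  obtain s where s: "\<And>y. y > 0 \<Longrightarrow> f c + s * c \<le> f y + s * y"
    using ex_subgradient[OF f' c] by blast
  have "(\<Sum>i<d. f (\<nu> i) + s * \<nu> i) < (\<Sum>i<d. f (x i) + s * x i)"
  proof (rule sum_strict_mono_ex1)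
    show "\<forall>i\<in>{..<d}. f (\<nu> i) + s * \<nu> i \<le> f (x i) + s * x i"
    proof
      fix i assume "i \<in> {..<d}"
      then show "f (\<nu> i) + s * \<nu> i \<le> f (x i) + s * x i"
        using convex_between_le[OF convex_on_add_linear[OF f'], of c "x i" "\<nu> i" s] s[of "x i"] c x seg
        by simp
    qed
    have "f (\<nu> i) + s * \<nu> i < f (x i) + s * x i"
      using strictly_convex_between_less[OF strictly_convex_on_add_linear[OF f], of c "x i" "\<nu> i" s]
        s c x seg ne i by simp
    then show "\<exists>i\<in>{..<d}. f (\<nu> i) + s * \<nu> i < f (x i) + s * x i" using i by blast
  qed simp
  then show False using sum eq by (simp add: sum.distrib flip: sum_distrib_left)
qed

lemma strictly_convex_on_square: "strictly_convex_on {0<..} (\<lambda>x. x\<^sup>2)"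
  unfolding strictly_convex_on_def
proof (intro conjI ballI allI impI)
  fix x y u :: real assume u: "x \<noteq> y" "0 < u" "u < 1"
  \<comment> \<open>This quantity is exactly the gap between the two sides.\<close>
  then have "0 < u * (1 - u) * (x - y)\<^sup>2" by simp
  then show "(u * x + (1 - u) * y)\<^sup>2 < u * x\<^sup>2 + (1 - u) * y\<^sup>2"
    by (simp add: power2_eq_square algebra_simps)
qed simp

lemma strictly_convex_on_inverse: "strictly_convex_on {0<..} (\<lambda>x. 1 / x)"
  unfolding strictly_convex_on_def
proof (intro conjI ballI allI impI)
  fix x y u :: real assume xy: "x \<in> {0<..}" "y \<in> {0<..}" and u: "x \<noteq> y" "0 < u" "u < 1"
  have pos: "0 < u * x + (1 - u) * y" using xy u by (intro add_pos_pos mult_pos_pos) auto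
  \<comment> \<open>The products of unlike terms give x/y + y/x, and x/y + y/x - 2 = (x - y)^2 / (x
    * y).\<close>
  have "(u * (1 / x) + (1 - u) * (1 / y)) * (u * x + (1 - u) * y) = 1 + u * (1 - u) * (x - y)\<^sup>2 / (x * y)"
    using xy by (simp add: field_simps power2_eq_square)
  also have "\<dots> > 1" using xy u by simp
  finally show "1 / (u * x + (1 - u) * y) < u * (1 / x) + (1 - u) * (1 / y)"
    using pos by (simp add: pos_divide_less_eq)
qed simp

section \<open>Vectors with prescribed norms and frame operator\<close>

lemma sqnorm_rotate:
  fixes g h :: "complex vec"
  assumes "g \<in> carrier_vec d" "h \<in> carrier_vec d"
  shows "sqnorm (complex_of_real a \<cdot>\<^sub>v g + complex_of_real b \<cdot>\<^sub>v h) =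
    a\<^sup>2 * sqnorm g + b\<^sup>2 * sqnorm h + 2 * a * b * Re (g \<bullet>c h)"
proof -
  let ?w = "complex_of_real a \<cdot>\<^sub>v g + complex_of_real b \<cdot>\<^sub>v h"
  have sq: "sqnorm v = (\<Sum>i<d. (Re (v $ i))\<^sup>2 + (Im (v $ i))\<^sup>2)" if "v \<in> carrier_vec d" for v
    using that by (simp add: sqnorm_def cscalar_prod_sum[of _ d] power2_eq_square)
  have re: "Re (g \<bullet>c h) = (\<Sum>i<d. Re (g $ i) * Re (h $ i) + Im (g $ i) * Im (h $ i))"
    using assms by (simp add: cscalar_prod_sum[of _ d])
  have "sqnorm ?w = (\<Sum>i<d. (Re (?w $ i))\<^sup>2 + (Im (?w $ i))\<^sup>2)" using assms by (intro sq) auto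
  also have "\<dots> = (\<Sum>i<d. a\<^sup>2 * ((Re (g $ i))\<^sup>2 + (Im (g $ i))\<^sup>2) +
      b\<^sup>2 * ((Re (h $ i))\<^sup>2 + (Im (h $ i))\<^sup>2) +
      2 * a * b * (Re (g $ i) * Re (h $ i) + Im (g $ i) * Im (h $ i)))"
    using assms by (intro sum.cong refl) (simp add: algebra_simps power2_eq_square)
  also have "\<dots> = a\<^sup>2 * sqnorm g + b\<^sup>2 * sqnorm h + 2 * a * b * Re (g \<bullet>c h)"
    unfolding sq[OF assms(1)] sq[OF assms(2)] re sum_distrib_left sum.distrib[symmetric] by (rule refl)
  finally show ?thesis .
qed

text \<open>A real rotation of the pair (g, h) preserves the sum of their rank one operators and the
  sum of the squared norms. As the angle goes from 0 to pi/2, the squared norm of the first vector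
  moves continuously from that of g to that of h and takes the value b on the way.\<close>

lemma rotate_pair:
  fixes g h :: "complex vec"
  assumes g: "g \<in> carrier_vec d" and h: "h \<in> carrier_vec d" and b: "sqnorm h \<le> b" "b \<le> sqnorm g"
  obtains g' h' where "g' \<in> carrier_vec d" "h' \<in> carrier_vec d" "sqnorm g' = b"
    "sqnorm h' = sqnorm g + sqnorm h - b"
    "\<And>G. set G \<subseteq> carrier_vec d \<Longrightarrow> frame_operator d (g' # h' # G) = frame_operator d (g # h # G)"
proof -
  define \<phi> where "\<phi> \<theta> = (cos \<theta>)\<^sup>2 * sqnorm g + (sin \<theta>)\<^sup>2 * sqnorm h + 2 * cos \<theta> * sin \<theta> * Re (g \<bullet>c h)" for \<theta>
  have "\<exists>\<theta>. 0 \<le> \<theta> \<and> \<theta> \<le> pi / 2 \<and> \<phi> \<theta> = b"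
    by (rule IVT2') (use b in \<open>auto simp: \<phi>_def intro!: continuous_intros\<close>)
  then obtain \<theta> where \<theta>: "\<phi> \<theta> = b" by blast
  define u v where "u = cos \<theta>" and "v = sin \<theta>"
  have uv: "u\<^sup>2 + v\<^sup>2 = 1" by (simp add: u_def v_def)
  define g' h' where "g' = complex_of_real u \<cdot>\<^sub>v g + complex_of_real v \<cdot>\<^sub>v h"
    and "h' = complex_of_real (- v) \<cdot>\<^sub>v g + complex_of_real u \<cdot>\<^sub>v h"
  have c: "g' \<in> carrier_vec d" "h' \<in> carrier_vec d" using g h by (auto simp: g'_def h'_def)
  have ng: "sqnorm g' = b"
    unfolding g'_def sqnorm_rotate[OF g h] using \<theta> by (simp add: \<phi>_def u_def v_def)
  have "sqnorm g' + sqnorm h' = (u\<^sup>2 + v\<^sup>2) * (sqnorm g + sqnorm h)"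
    unfolding g'_def h'_def sqnorm_rotate[OF g h] by (simp add: algebra_simps)
  then have nh: "sqnorm h' = sqnorm g + sqnorm h - b" using uv ng by simp
  have uv': "complex_of_real u * complex_of_real u + complex_of_real v * complex_of_real v = 1"
    using uv by (simp add: power2_eq_square flip: of_real_mult of_real_add)
  \<comment> \<open>The primed arguments will be conjugated entries; as u and v are real,
    conjugation passes through the combination.\<close>
  have rot: "(u * x + v * y) * (u * x' + v * y') + (- v * x + u * y) * (- v * x' + u * y') = x * x' + y * y'"
    for x y x' y' :: complex
  proof -
    have "(u * x + v * y) * (u * x' + v * y') + (- v * x + u * y) * (- v * x' + u * y') =
      (complex_of_real u * complex_of_real u + complex_of_real v * complex_of_real v) * (x * x' + y * y')"
      by (simp add: algebra_simps)
    then show ?thesis by (simp only: uv' mult_1)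
  qed
  have "frame_operator d (g' # h' # G) = frame_operator d (g # h # G)" if G: "set G \<subseteq> carrier_vec d" for G
  proof (rule eq_matI)
    have *: "set (g' # h' # G) \<subseteq> carrier_vec d" "set (g # h # G) \<subseteq> carrier_vec d" using c g h G by auto
    show "dim_row (frame_operator d (g' # h' # G)) = dim_row (frame_operator d (g # h # G))"
      "dim_col (frame_operator d (g' # h' # G)) = dim_col (frame_operator d (g # h # G))"
      unfolding frame_operator_dim[OF *(1)] frame_operator_dim[OF *(2)] by simp_all
    fix i j assume "i < dim_row (frame_operator d (g # h # G))" "j < dim_col (frame_operator d (g # h # G))"
    then have ij: "i < d" "j < d" unfolding frame_operator_dim[OF *(2)] by simp_all
    have "g' $ i * cnj (g' $ j) + h' $ i * cnj (h' $ j) = g $ i * cnj (g $ j) + h $ i * cnj (h $ j)"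
      using ij g h rot[of "g $ i" "h $ i" "cnj (g $ j)" "cnj (h $ j)"] by (simp add: g'_def h'_def)
    then show "frame_operator d (g' # h' # G) $$ (i, j) = frame_operator d (g # h # G) $$ (i, j)"
      unfolding frame_operator_index[OF *(1) ij] frame_operator_index[OF *(2) ij]
      by (simp flip: add.assoc)
  qed
  then show ?thesis using that c ng nh by blast
qed

text \<open>A discrete intermediate value theorem: somewhere along the list the values pass from at
  least b to at most b.\<close>

lemma split_adjacent:
  fixes f :: "'a \<Rightarrow> real"
  assumes "length hs \<ge> 2" "f (hd hs) \<ge> b" "f (last hs) \<le> b"
  shows "\<exists>A p q B. hs = A @ p # q # B \<and> f p \<ge> b \<and> f q \<le> b"
  using assms
proof (induction hs)
  case (Cons h hs)
  then obtain h' hs' where hs: "hs = h' # hs'" by (cases hs) auto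
  show ?case
  proof (cases "f h' \<le> b")
    case True
    then show ?thesis using Cons.prems hs by (intro exI[of _ "[]"]) auto
  next
    case False
    then have "hs' \<noteq> []" using Cons.prems hs by auto
    then have "\<exists>A p q B. hs = A @ p # q # B \<and> f p \<ge> b \<and> f q \<le> b"
      using Cons False hs by (cases hs') auto
    then show ?thesis by (metis append_Cons)
  qed
qed simp

lemma sum_list_take_le:
  fixes xs :: "real list"
  assumes "\<forall>x\<in>set xs. x \<le> b" "i \<le> length xs"
  shows "sum_list (take i xs) \<le> of_nat i * b"
proof -
  have "sum_list (take i xs) \<le> of_nat (length (take i xs)) * b"
    using assms(1) sum_list_mono[of "take i xs" "\<lambda>x. x" "\<lambda>_. b"]
    by (auto simp: sum_list_triv dest: in_set_takeD)
  then show ?thesis using assms(2) by simp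
qed

lemma sum_list_take_ge:
  fixes xs :: "real list"
  assumes "\<forall>x\<in>set (take i xs). b \<le> x" "i \<le> length xs"
  shows "of_nat i * b \<le> sum_list (take i xs)"
  using assms sum_list_mono[of "take i xs" "\<lambda>_. b" "\<lambda>x. x"]
  by (simp add: sum_list_triv)

text \<open>Horn's induction: the largest prescribed norm lies between two adjacent given norms. Rotating
  these two vectors realizes it, and the remaining vectors are still in decreasing order.\<close>

lemma schur_horn_sorted:
  assumes "length bs = length hs" "set hs \<subseteq> carrier_vec d"
    and "sorted_wrt (\<ge>) bs" "sorted_wrt (\<ge>) (map sqnorm hs)"
    and "\<forall>i\<le>length bs. sum_list (take i bs) \<le> sum_list (take i (map sqnorm hs))"
    and "sum_list bs = sum_list (map sqnorm hs)"
  shows "\<exists>gs. set gs \<subseteq> carrier_vec d \<and> map sqnorm gs = bs \<and> frame_operator d gs = frame_operator d hs"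
  using assms
proof (induction bs arbitrary: hs)
  case Nil
  then show ?case by auto
next
  case (Cons b bs)
  show ?case
  proof (cases "bs = []")
    case True
    then have "map sqnorm hs = b # bs" using Cons.prems by (cases hs) auto
    then show ?thesis using Cons.prems(2) by (intro exI[of _ hs]) simp
  next
    case False
    have len: "length hs \<ge> 2" using False Cons.prems(1) by (cases bs) auto
    have hs0: "hs \<noteq> []" using len by auto
    have bsb: "\<forall>x\<in>set bs. x \<le> b" using Cons.prems by auto
    have "b \<le> sqnorm (hd hs)"
      using Cons.prems(5)[rule_format, of 1] hs0 by (cases hs) auto
    \<comment> \<open>Otherwise all given norms would exceed b, while no prescribed norm does; two
      lists of equal length would then have different sums.\<close>
    moreover have "sqnorm (last hs) \<le> b"
    proof (rule ccontr)
      assume *: "\<not> sqnorm (last hs) \<le> b"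
      have "sqnorm (last hs) \<le> sqnorm h" if h: "h \<in> set hs" for h
      proof -
        obtain i where "i < length hs" "h = hs ! i" using h by (auto simp: in_set_conv_nth)
        moreover have "last hs = hs ! (length hs - 1)" using hs0 by (simp add: last_conv_nth)
        ultimately show ?thesis
          using Cons.prems(4) unfolding sorted_wrt_iff_nth_less
          by (cases "i = length hs - 1") auto
      qed
      then have "real (length hs) * sqnorm (last hs) \<le> sum_list (map sqnorm hs)"
        using sum_list_take_ge[of "length hs" "map sqnorm hs" "sqnorm (last hs)"] by auto
      moreover have "sum_list (b # bs) \<le> real (length (b # bs)) * b"
        using sum_list_take_le[of "b # bs" b "length (b # bs)"] bsb by simp
      then have "sum_list (b # bs) \<le> real (length hs) * b" unfolding Cons.prems(1) .
      moreover have "real (length hs) * b < real (length hs) * sqnorm (last hs)"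
        using * hs0 by simp
      ultimately show False using Cons.prems(6) by linarith
    qed
    ultimately obtain A p q B where hs: "hs = A @ p # q # B" and pq: "sqnorm p \<ge> b" "sqnorm q \<le> b"
      using split_adjacent[OF len, of b sqnorm] by blast
    have c: "p \<in> carrier_vec d" "q \<in> carrier_vec d" "set (A @ B) \<subseteq> carrier_vec d"
      using Cons.prems(2) hs by auto
    obtain p' q' where p': "p' \<in> carrier_vec d" "q' \<in> carrier_vec d" "sqnorm p' = b"
      "sqnorm q' = sqnorm p + sqnorm q - b"
      and fo: "\<And>G. set G \<subseteq> carrier_vec d \<Longrightarrow> frame_operator d (p' # q' # G) = frame_operator d (p # q # G)"
      using rotate_pair[OF c(1,2) pq(2,1)] by blast
    \<comment> \<open>The squared norm of q' lies between those of q and p, so q' may take their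
      place without disturbing the order.\<close>
    let ?hs = "A @ q' # B"
    have "\<exists>gs. set gs \<subseteq> carrier_vec d \<and> map sqnorm gs = bs \<and> frame_operator d gs = frame_operator d ?hs"
    proof (rule Cons.IH)
      show "length bs = length ?hs" "set ?hs \<subseteq> carrier_vec d" "sorted_wrt (\<ge>) bs"
        using Cons.prems c p' hs by auto
      show "sorted_wrt (\<ge>) (map sqnorm ?hs)"
        using Cons.prems(4) p' pq unfolding hs by (fastforce simp: sorted_wrt_append)
      show "sum_list bs = sum_list (map sqnorm ?hs)" using Cons.prems(6) p' hs by simp
      show "\<forall>i\<le>length bs. sum_list (take i bs) \<le> sum_list (take i (map sqnorm ?hs))"
      proof (intro allI impI)
        fix i assume i: "i \<le> length bs"
        \<comment> \<open>Up to the end of A, every prescribed norm is at most b and every given one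
          at least b. Beyond it, the inequality follows from the given one for i + 1 entries: by the
          rotation, p and q contribute b plus the squared norm of q', and b cancels.\<close>
        show "sum_list (take i bs) \<le> sum_list (take i (map sqnorm ?hs))"
        proof (cases "i \<le> length A")
          case True
          have "sum_list (take i bs) \<le> real i * b" by (rule sum_list_take_le[OF bsb i])
          also have "\<forall>a\<in>set A. b \<le> sqnorm a"
            using Cons.prems(4) pq unfolding hs by (fastforce simp: sorted_wrt_append)
          then have "real i * b \<le> sum_list (take i (map sqnorm A))"
            using True by (intro sum_list_take_ge) (auto dest!: in_set_takeD)
          also have "\<dots> = sum_list (take i (map sqnorm ?hs))" using True by simp
          finally show ?thesis .
        next
          case False
          then obtain l where l: "i = length A + Suc l" by (metis add_Suc_right less_imp_Suc_add not_le)
          have "sum_list (take (Suc i) (b # bs)) \<le> sum_list (take (Suc i) (map sqnorm hs))"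
            using Cons.prems(5) i by (metis Suc_le_mono length_Cons)
          then show ?thesis using p' by (simp add: hs l)
        qed
      qed
    qed
    then obtain gs where gs: "set gs \<subseteq> carrier_vec d" "map sqnorm gs = bs"
      "frame_operator d gs = frame_operator d ?hs" by blast
    have "frame_operator d (p' # gs) = frame_operator d (p' # ?hs)"
      using gs by (simp add: frame_operator_Cons)
    also have "\<dots> = frame_operator d (p' # q' # A @ B)"
      using c p' by (intro frame_operator_mset) auto
    also have "\<dots> = frame_operator d (p # q # A @ B)" by (rule fo[OF c(3)])
    also have "\<dots> = frame_operator d hs" using c hs by (intro frame_operator_mset) auto
    finally show ?thesis using gs p' by (intro exI[of _ "p' # gs"]) auto
  qed
qed

lemma sorted_wrt_rev_sort: "sorted_wrt (\<ge>) (rev (sort xs))" for xs :: "'a :: linorder list"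
  by (simp add: sorted_wrt_rev)

text \<open>Permutes vectors so that their norms appear in a prescribed order; this undoes the
  sorting needed for the induction above.\<close>

lemma map_preimage_mset:
  assumes "mset bs = image_mset f (mset gs)"
  shows "\<exists>gs'. mset gs' = mset gs \<and> map f gs' = bs"
  using assms
proof (induction bs arbitrary: gs)
  case (Cons b bs)
  then obtain g where g: "g \<in># mset gs" "f g = b" "image_mset f (mset gs - {#g#}) = mset bs"
    by (metis (no_types, lifting) image_mset_add_mset add_mset_remove_trivial_eq add_mset_add_mset_same_iff
        imageE insert_DiffM set_image_mset union_single_eq_member add_mset_add_single mset.simps(2))
  have "mset (remove1 g gs) = mset gs - {#g#}" by simp
  then obtain gs' where "mset gs' = mset (remove1 g gs)" "map f gs' = bs" using Cons.IH[of "remove1 g gs"] g by auto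
  then show ?case using g by (intro exI[of _ "g # gs'"]) auto
qed simp

text \<open>Zero vectors bring hs to the length of b, as in the convention for majorization, without
  changing the frame operator. Sorting is harmless because the frame operator depends only on the
  multiset of vectors.\<close>

lemma schur_horn:
  assumes hs: "set hs \<subseteq> carrier_vec d" and len: "length hs \<le> length b" and maj: "b \<prec>\<^sub>m map sqnorm hs"
  obtains gs where "set gs \<subseteq> carrier_vec d" "map sqnorm gs = b" "frame_operator d gs = frame_operator d hs"
proof -
  let ?zs = "replicate (length b - length hs) (0\<^sub>v d)"
  let ?hs = "hs @ ?zs"
  define hs' where "hs' = rev (sort_key sqnorm ?hs)"
  have ms: "mset hs' = mset ?hs" by (simp add: hs'_def)
  have "sqnorm (0\<^sub>v d) = 0" using sqnorm_eq_0_iff[of "0\<^sub>v d"] by simp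
  then have hsz: "map sqnorm ?hs = map sqnorm hs @ replicate (length b - length hs) 0" by simp
  have "map sqnorm hs' = rev (map sqnorm (sort_key sqnorm ?hs))" by (simp only: hs'_def rev_map)
  also have "map sqnorm (sort_key sqnorm ?hs) = sort (map sqnorm ?hs)"
    by (rule properties_for_sort[symmetric]) simp_all
  finally have hs'n: "map sqnorm hs' = decreasing_padded (length b) (map sqnorm hs)"
    by (simp only: decreasing_padded_def hsz length_map)
  have b': "decreasing_padded (length b) b = rev (sort b)" by (simp add: decreasing_padded_def)
  have max: "max (length b) (length (map sqnorm hs)) = length b" using len by simp
  have "\<exists>gs. set gs \<subseteq> carrier_vec d \<and> map sqnorm gs = rev (sort b) \<and> frame_operator d gs = frame_operator d hs'"
  proof (rule schur_horn_sorted)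
    show "length (rev (sort b)) = length hs'" using len by (simp add: hs'_def)
    have "set hs' = set ?hs" by (simp add: hs'_def)
    then show "set hs' \<subseteq> carrier_vec d" using hs by auto
    show "sorted_wrt (\<ge>) (rev (sort b))" "sorted_wrt (\<ge>) (map sqnorm hs')"
      unfolding hs'n decreasing_padded_def by (simp_all only: sorted_wrt_rev_sort)
    show "\<forall>i\<le>length (rev (sort b)). sum_list (take i (rev (sort b))) \<le> sum_list (take i (map sqnorm hs'))"
      using maj unfolding majorized_def Let_def max b' hs'n by simp
    have "sum_list (rev (sort b)) = sum_list b" by (metis mset_rev mset_sort sum_mset_sum_list)
    moreover have "sum_list (map sqnorm hs') = sum_list (map sqnorm ?hs)"
      using ms by (metis mset_map sum_mset_sum_list)
    ultimately show "sum_list (rev (sort b)) = sum_list (map sqnorm hs')"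
      using maj unfolding majorized_def Let_def hsz by (simp add: sum_list_replicate)
  qed
  then obtain gs where gs: "set gs \<subseteq> carrier_vec d" "map sqnorm gs = rev (sort b)"
    "frame_operator d gs = frame_operator d hs'" by blast
  have "mset b = image_mset sqnorm (mset gs)" using gs(2) by (metis mset_map mset_rev mset_sort)
  then obtain gs' where gs': "mset gs' = mset gs" "map sqnorm gs' = b" using map_preimage_mset by blast
  have "frame_operator d ?hs = frame_operator d hs"
  proof (rule eq_matI)
    have z: "set ?zs \<subseteq> carrier_vec d" by auto
    have *: "set ?hs \<subseteq> carrier_vec d" using hs by auto
    show "dim_row (frame_operator d ?hs) = dim_row (frame_operator d hs)"
      "dim_col (frame_operator d ?hs) = dim_col (frame_operator d hs)"
      unfolding frame_operator_dim[OF *] frame_operator_dim[OF hs] by simp_all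
    fix i j assume "i < dim_row (frame_operator d hs)" "j < dim_col (frame_operator d hs)"
    then have ij: "i < d" "j < d" unfolding frame_operator_dim[OF hs] by simp_all
    show "frame_operator d ?hs $$ (i, j) = frame_operator d hs $$ (i, j)"
      unfolding frame_operator_index[OF * ij] frame_operator_index[OF hs ij]
      using ij by (simp add: sum_list_replicate)
  qed
  moreover have "set gs' \<subseteq> carrier_vec d" using gs'(1) gs(1) by (metis set_mset_mset)
  moreover have "frame_operator d hs' = frame_operator d ?hs"
    using ms hs by (intro frame_operator_mset) (auto simp: hs'_def)
  ultimately show ?thesis using that[of gs'] gs gs' frame_operator_mset[OF gs'(1)] by simp
qed

section \<open>The optimal spectrum\<close>

lemma sum_list_take_Suc:
  fixes xs :: "real list"
  shows "q < length xs \<Longrightarrow> sum_list (take (Suc q) xs) = sum_list (take q xs) + xs ! q"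
  by (simp add: take_Suc_conv_app_nth)

lemma sorted_wrt_ge_nth:
  fixes xs :: "real list"
  shows "sorted_wrt (\<ge>) xs \<Longrightarrow> i \<le> j \<Longrightarrow> j < length xs \<Longrightarrow> xs ! j \<le> xs ! i"
  unfolding sorted_wrt_iff_nth_less by (cases "i = j") auto

text \<open>The last index always qualifies: there the quotient has denominator 1, and t is at least
  the sum of all entries.\<close>

lemma r_lam_ex:
  assumes "lam \<noteq> []" "t \<ge> sum_list lam"
  shows "\<exists>q. q < length lam \<and> p_lam lam q t \<ge> lam ! q"
proof (intro exI[of _ "length lam - 1"] conjI)
  have "sum_list lam = sum_list (take (length lam - 1) lam) + lam ! (length lam - 1)"
    using assms sum_list_take_Suc[of "length lam - 1" lam] by simp
  then show "p_lam lam (length lam - 1) t \<ge> lam ! (length lam - 1)"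
    using assms by (simp add: p_lam_def of_nat_diff Suc_leI)
qed (use assms in simp)

text \<open>Water filling: c is the level to which the entries from index r on must be raised for
  the total to become t, and minimality of r keeps the earlier entries above this level.\<close>

lemma c_lam_props:
  assumes ne: "lam \<noteq> []" and dec: "sorted_wrt (\<ge>) lam"
    and t: "t \<ge> sum_list lam"
  shows "r_lam lam t < length lam" "lam ! r_lam lam t \<le> c_lam lam t"
    "\<And>i. i < r_lam lam t \<Longrightarrow> c_lam lam t < lam ! i"
    "sum_list (take (r_lam lam t) lam) + real (length lam - r_lam lam t) * c_lam lam t = t"
proof -
  note dec' = sorted_wrt_ge_nth[OF dec]
  define q where "q = r_lam lam t"
  have q: "q < length lam \<and> p_lam lam q t \<ge> lam ! q"
    unfolding q_def r_lam_def by (rule LeastI_ex[OF r_lam_ex[OF ne t]])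
  then show "r_lam lam t < length lam" "lam ! r_lam lam t \<le> c_lam lam t"
    by (auto simp: q_def c_lam_def)
  have pos: "real (length lam) - real q > 0" using q by simp
  have c: "c_lam lam t = p_lam lam q t" by (simp add: c_lam_def q_def)
  show sum: "sum_list (take (r_lam lam t) lam) + real (length lam - r_lam lam t) * c_lam lam t = t"
    using q pos unfolding c q_def[symmetric] by (simp add: p_lam_def of_nat_diff)
  fix i assume i: "i < r_lam lam t"
  then obtain q' where q': "q = Suc q'" unfolding q_def by (cases "r_lam lam t") auto
  have "\<not> (q' < length lam \<and> p_lam lam q' t \<ge> lam ! q')"
    using not_less_Least[of q' "\<lambda>q. q < length lam \<and> p_lam lam q t \<ge> lam ! q"] q'
    by (simp add: q_def r_lam_def)
  then have "p_lam lam q' t < lam ! q'" using q q' by auto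
  moreover have pos': "real (length lam) - real q' > 0" using q q' by simp
  \<comment> \<open>The predecessor q' of q fails the test; subtracting \<open>lam ! q'\<close> from
    both sides turns the failure at q' into an upper bound for the quotient at q.\<close>
  ultimately have "t - sum_list (take q' lam) < (real (length lam) - real q') * lam ! q'"
    by (simp add: p_lam_def pos_divide_less_eq mult.commute)
  then have "t - sum_list (take q lam) < (real (length lam) - real q) * lam ! q'"
    using q q' by (simp add: sum_list_take_Suc algebra_simps)
  then have "c_lam lam t < lam ! q'"
    unfolding c p_lam_def using pos by (simp add: pos_divide_less_eq mult.commute)
  also have "\<dots> \<le> lam ! i" using dec'[of i q'] q q' i by (simp add: q_def)
  finally show "c_lam lam t < lam ! i" .
qed

lemma c_lam_m_eq_c_lam: "m = 0 \<or> t \<le> s_star lam m \<Longrightarrow> c_lam_m lam m t = c_lam lam t"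
  by (simp add: c_lam_m_def)

text \<open>The excess of t over s* is spread evenly over d - m places, which all start from the
  level of the last of the m leading entries.\<close>

lemma c_lam_m_large:
  assumes "m > 0" "m < length lam" "t > s_star lam m"
  shows "lam ! (m - 1) < c_lam_m lam m t"
    "sum_list (take m lam) + real (length lam - m) * c_lam_m lam m t = t"
proof -
  have pos: "real (length lam) - real m > 0" using assms by simp
  have c: "c_lam_m lam m t = lam ! (m - 1) + (t - s_star lam m) / (real (length lam) - real m)"
    using assms by (simp add: c_lam_m_def)
  show "lam ! (m - 1) < c_lam_m lam m t" using assms pos by (simp add: c)
  have "real (length lam - m) * c_lam_m lam m t =
    (real (length lam) - real m) * lam ! (m - 1) + (t - s_star lam m)"
    using assms pos by (simp add: c distrib_left of_nat_diff)
  then show "sum_list (take m lam) + real (length lam - m) * c_lam_m lam m t = t"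
    by (simp add: s_star_def)
qed

lemma r_lam_m_props:
  assumes ne: "lam \<noteq> []" and dec: "sorted_wrt (\<ge>) lam"
    and t: "t \<ge> sum_list lam" and m: "m < length lam"
  shows "r_lam_m lam m t < length lam" "lam ! r_lam_m lam m t \<le> c_lam_m lam m t"
    "\<And>i. i < r_lam_m lam m t \<Longrightarrow> c_lam_m lam m t < lam ! i"
proof -
  note cl = c_lam_props[OF ne dec t]
  have "r_lam_m lam m t < length lam \<and> lam ! r_lam_m lam m t \<le> c_lam_m lam m t \<and>
    (\<forall>i < r_lam_m lam m t. c_lam_m lam m t < lam ! i)"
  proof (cases "m = 0")
    case True
    then show ?thesis using cl by (simp add: r_lam_m_def c_lam_m_def)
  next
    case False
    let ?P = "\<lambda>q. q < length lam \<and> c_lam_m lam m t \<ge> lam ! q"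
    have r: "r_lam_m lam m t = (LEAST q. ?P q)" using False by (simp add: r_lam_m_def)
    have "\<exists>q. ?P q"
    proof (cases "t \<le> s_star lam m")
      case True
      then show ?thesis using cl by (auto simp: c_lam_m_eq_c_lam)
    next
      case False
      then show ?thesis using c_lam_m_large(1)[of m lam t] m \<open>m \<noteq> 0\<close>
        by (intro exI[of _ "m - 1"]) auto
    qed
    then have P: "?P (r_lam_m lam m t)" unfolding r by (rule LeastI_ex)
    moreover have "c_lam_m lam m t < lam ! i" if i: "i < r_lam_m lam m t" for i
      using not_less_Least[OF i[unfolded r]] i P by auto
    ultimately show ?thesis by blast
  qed
  then show "r_lam_m lam m t < length lam" "lam ! r_lam_m lam m t \<le> c_lam_m lam m t"
    "\<And>i. i < r_lam_m lam m t \<Longrightarrow> c_lam_m lam m t < lam ! i" by auto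
qed

text \<open>Both indices mark the first entry that is at most the same level c.\<close>

lemma r_lam_m_eq_r_lam:
  assumes ne: "lam \<noteq> []" and dec: "sorted_wrt (\<ge>) lam"
    and t: "t \<ge> sum_list lam" and m: "m < length lam" and ts: "m = 0 \<or> t \<le> s_star lam m"
  shows "r_lam_m lam m t = r_lam lam t"
proof -
  note cl = c_lam_props[OF ne dec t] and rm = r_lam_m_props[OF ne dec t m]
  show ?thesis
  proof (rule linorder_cases[of "r_lam_m lam m t" "r_lam lam t"])
    assume "r_lam_m lam m t < r_lam lam t"
    then show ?thesis using cl(3) rm(2) by (fastforce simp: c_lam_m_eq_c_lam[OF ts])
  next
    assume "r_lam lam t < r_lam_m lam m t"
    then show ?thesis using cl(2) rm(3) by (fastforce simp: c_lam_m_eq_c_lam[OF ts])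
  qed
qed

text \<open>The three cases in the definition of nu_list have a common form: for t at most s* and
  rho < m the entries of lam with indices from rho to m - 1 are all equal to c.\<close>

lemma nu_list_uniform:
  assumes ne: "lam \<noteq> []" and dec: "sorted_wrt (\<ge>) lam"
    and t: "t \<ge> sum_list lam" and m: "m < length lam"
    and c: "c = c_lam_m lam m t" and \<rho>: "\<rho> = r_lam_m lam m t" and r: "r = max \<rho> m"
  shows "nu_list lam m t = take \<rho> lam @ replicate (length lam - r) c @ drop \<rho> (take r lam)"
    "sum_list (take r lam) + real (length lam - r) * c = t"
proof -
  note dec' = sorted_wrt_ge_nth[OF dec]
  note cl = c_lam_props[OF ne dec t]
  have rm: "\<rho> < length lam" "lam ! \<rho> \<le> c" "\<And>i. i < \<rho> \<Longrightarrow> c < lam ! i"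
    using r_lam_m_props[OF ne dec t m] unfolding c \<rho> by auto
  have "nu_list lam m t = take \<rho> lam @ replicate (length lam - r) c @ drop \<rho> (take r lam) \<and>
    sum_list (take r lam) + real (length lam - r) * c = t"
  proof (cases "m = 0 \<or> t \<le> s_star lam m")
    case True
    then have cc: "c = c_lam lam t" using c by (simp add: c_lam_m_eq_c_lam)
    have \<rho>\<rho>: "\<rho> = r_lam lam t" using r_lam_m_eq_r_lam[OF ne dec t m True] \<rho> by simp
    have nu: "nu_list lam m t = take \<rho> lam @ replicate (length lam - \<rho>) c"
      using True by (simp add: nu_list_def Let_def c \<rho>)
    have sum: "sum_list (take \<rho> lam) + real (length lam - \<rho>) * c = t" using cl(4) by (simp add: cc \<rho>\<rho>)
    show ?thesis
    proof (cases "m \<le> \<rho>")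
      case True
      then show ?thesis using nu sum r by simp
    next
      case False
      then have r: "r = m" and m0: "m > 0" "\<rho> < m" using r by auto
      have ts: "t \<le> s_star lam m" using True m0 by auto
      have le: "lam ! i \<le> c" if "\<rho> \<le> i" "i < length lam" for i using dec'[OF that] rm(2) by simp
      have split: "take m lam = take \<rho> lam @ drop \<rho> (take m lam)"
        using m0 append_take_drop_id[of \<rho> "take m lam"] by (simp add: min_def)
      have "x \<le> lam ! \<rho>" if x: "x \<in> set (drop \<rho> (take m lam))" for x
      proof -
        obtain i where "i < m - \<rho>" "x = lam ! (\<rho> + i)" using x m by (auto simp: in_set_conv_nth)
        then show ?thesis using dec'[of \<rho> "\<rho> + i"] m by simp
      qed
      then have dr: "sum_list (drop \<rho> (take m lam)) \<le> real (m - \<rho>) * lam ! \<rho>"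
        using sum_list_mono[of "drop \<rho> (take m lam)" "\<lambda>x. x" "\<lambda>_. lam ! \<rho>"] m
        by (simp add: sum_list_triv)
      have lm: "lam ! (m - 1) \<le> c" using le m m0 by auto
      \<comment> \<open>The bound t \<le> s* compares d - rho copies of c with numbers that are all
        at most c, so these must all equal c: first the entry at m - 1, then by monotonicity the
        entries from rho to m - 1.\<close>
      have "real (length lam - \<rho>) * c \<le> sum_list (drop \<rho> (take m lam)) + real (length lam - m) * lam ! (m - 1)"
        using ts sum m split unfolding s_star_def by (metis add_le_cancel_left add.assoc of_nat_diff less_imp_le sum_list_append)
      also have "\<dots> \<le> real (m - \<rho>) * lam ! \<rho> + real (length lam - m) * lam ! (m - 1)"
        using dr by simp
      finally have *: "real (m - \<rho>) * c + real (length lam - m) * c \<le>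
          real (m - \<rho>) * lam ! \<rho> + real (length lam - m) * lam ! (m - 1)"
        using m m0 by (simp add: of_nat_diff algebra_simps)
      have "real (m - \<rho>) * lam ! \<rho> \<le> real (m - \<rho>) * c" using rm(2) by (intro mult_left_mono) auto
      then have "real (length lam - m) * c \<le> real (length lam - m) * lam ! (m - 1)" using * by linarith
      then have "c \<le> lam ! (m - 1)" using m by simp
      then have eq: "lam ! i = c" if "\<rho> \<le> i" "i < m" for i
        using le[of i] dec'[of i "m - 1"] that m by fastforce
      have dr': "drop \<rho> (take m lam) = replicate (m - \<rho>) c"
        using m m0 eq by (intro nth_equalityI) auto
      have "replicate (length lam - \<rho>) c = replicate (length lam - m) c @ replicate (m - \<rho>) c"
        using m m0 by (simp flip: replicate_add)
      moreover have "sum_list (take m lam) + real (length lam - m) * c = t"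
        using sum m m0 by (subst split) (simp add: dr' sum_list_replicate of_nat_diff algebra_simps)
      ultimately show ?thesis using nu dr' r by simp
    qed
  next
    case False
    then have m0: "m > 0" and ts: "t > s_star lam m" by auto
    have big: "lam ! (m - 1) < c" "sum_list (take m lam) + real (length lam - m) * c = t"
      using c_lam_m_large[OF m0 m ts] by (auto simp: c)
    have "\<rho> < m"
    proof (rule ccontr)
      assume "\<not> \<rho> < m"
      then have "m - 1 < \<rho>" using m0 by linarith
      then show False using rm(3)[of "m - 1"] big by simp
    qed
    then have r: "r = m" using r by simp
    have "nu_list lam m t = take \<rho> lam @ replicate (length lam - m) c @ drop \<rho> (take m lam)"
    proof (cases "t < s_star_star lam m")
      case True
      then show ?thesis using False by (simp add: nu_list_def Let_def c \<rho>)
    next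
      case ge: False
      have "s_star_star lam m \<le> t" using ge by simp
      \<comment> \<open>Passing s** means that c reaches the largest entry; so rho = 0 and the third
        case is the general form with an empty first block.\<close>
      then have "real (length lam - m) * lam ! 0 \<le> real (length lam - m) * c"
        using big(2) unfolding s_star_star_def of_nat_diff[OF less_imp_le[OF m]] by linarith
      moreover have "0 < real (length lam - m)" using m by simp
      ultimately have "lam ! 0 \<le> c" by (simp only: mult_le_cancel_left_pos)
      then have "\<rho> = 0" using rm(3)[of 0] by (cases \<rho>) auto
      then show ?thesis using False ge by (simp add: nu_list_def Let_def c \<rho>)
    qed
    then show ?thesis using big r by simp
  qed
  then show "nu_list lam m t = take \<rho> lam @ replicate (length lam - r) c @ drop \<rho> (take r lam)"
    "sum_list (take r lam) + real (length lam - r) * c = t" by auto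
qed

lemma nu_list_nth:
  assumes ne: "lam \<noteq> []" and dec: "sorted_wrt (\<ge>) lam"
    and t: "t \<ge> sum_list lam" and m: "m < length lam"
    and c: "c = c_lam_m lam m t" and \<rho>: "\<rho> = r_lam_m lam m t" and r: "r = max \<rho> m"
    and i: "i < length lam"
  shows "nu_list lam m t ! i =
    (if i < \<rho> then lam ! i else if i < \<rho> + (length lam - r) then c else lam ! (i - (length lam - r)))"
proof -
  have "\<rho> < length lam" using r_lam_m_props(1)[OF ne dec t m] by (simp add: \<rho>)
  moreover have "nu_list lam m t = take \<rho> lam @ replicate (length lam - r) c @ drop \<rho> (take r lam)"
    by (rule nu_list_uniform(1)[OF ne dec t m c \<rho> r])
  ultimately show ?thesis using i r m by (auto simp: nth_append)
qed

text \<open>The multiset form forgets where the copies of c stand in \<open>nu_list\<close>; it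
  matches the diagonal that the constructed completion has in the eigenbasis of the frame operator
  of F0.\<close>

lemma nu_list_facts:
  assumes ne: "lam \<noteq> []" and dec: "sorted_wrt (\<ge>) lam"
    and t: "t \<ge> sum_list lam" and m: "m < length lam"
    and c: "c = c_lam_m lam m t" and r: "r = max (r_lam_m lam m t) m"
  shows "r < length lam" "\<And>j. r \<le> j \<Longrightarrow> j < length lam \<Longrightarrow> lam ! j \<le> c"
    "length (nu_list lam m t) = length lam"
    "mset (nu_list lam m t) = mset (map (\<lambda>j. if j < r then lam ! j else c) [0..<length lam])"
    "sum_list (nu_list lam m t) = t"
    "sorted (rev (nu_list lam m t))"
proof -
  note dec' = sorted_wrt_ge_nth[OF dec]
  define \<rho> where "\<rho> = r_lam_m lam m t"
  have rm: "\<rho> < length lam" "lam ! \<rho> \<le> c" "\<And>i. i < \<rho> \<Longrightarrow> c < lam ! i"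
    using r_lam_m_props[OF ne dec t m] unfolding c \<rho>_def by auto
  have r': "r = max \<rho> m" by (simp add: r \<rho>_def)
  note nu = nu_list_uniform[OF ne dec t m c \<rho>_def r']
  show rl: "r < length lam" using rm(1) m r' by simp
  show "lam ! j \<le> c" if "r \<le> j" "j < length lam" for j
    using dec'[of \<rho> j] rm(2) that r' by simp
  show len: "length (nu_list lam m t) = length lam"
    using rl r' rm(1) by (simp add: nu(1))
  have tk: "take r lam = take \<rho> lam @ drop \<rho> (take r lam)"
    using r' append_take_drop_id[of \<rho> "take r lam"] by (simp add: min_def)
  have ms: "mset (nu_list lam m t) = mset (take r lam) + mset (replicate (length lam - r) c)"
    using arg_cong[OF tk, of mset] by (simp add: nu(1))
  have "map (\<lambda>j. if j < r then lam ! j else c) [0..<length lam] = take r lam @ replicate (length lam - r) c"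
    using rl by (intro nth_equalityI) (auto simp: nth_append)
  then show "mset (nu_list lam m t) = mset (map (\<lambda>j. if j < r then lam ! j else c) [0..<length lam])"
    using ms by simp
  have "sum_list (nu_list lam m t) = sum_list (take r lam) + sum_list (replicate (length lam - r) c)"
    using ms by (metis mset_append sum_list_append sum_mset_sum_list)
  then show "sum_list (nu_list lam m t) = t" using nu(2) by (simp add: sum_list_replicate)
  have "nu_list lam m t ! j \<le> nu_list lam m t ! i" if ij: "i \<le> j" "j < length lam" for i j
  proof -
    have le: "lam ! l \<le> c" if "\<rho> \<le> l" "l < length lam" for l using dec'[OF that] rm(2) by simp
    note nth = nu_list_nth[OF ne dec t m c \<rho>_def r']
    have i: "i < length lam" using ij by simp
    show ?thesis
      unfolding nth[OF ij(2)] nth[OF i]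
      using ij rm dec' rl le r' by (auto intro: less_imp_le dest!: leI simp: le order.trans[OF le less_imp_le[OF rm(3)]])
  qed
  then show "sorted (rev (nu_list lam m t))"
    by (auto simp: sorted_rev_iff_nth_mono len)
qed

text \<open>An entry before rho is some lam_i with c < lam_i \<le> x_i, and an entry c is an
  endpoint. An entry after the copies of c is lam_(i-k), which is at most c and at least
  x_i.\<close>

lemma nu_list_between:
  assumes ne: "lam \<noteq> []" and dec: "sorted_wrt (\<ge>) lam"
    and t: "t \<ge> sum_list lam" and m: "m = length lam - k" "k > 0"
    and x: "\<And>i. i < length lam \<Longrightarrow> lam ! i \<le> x i"
    and xk: "\<And>i. i + k < length lam \<Longrightarrow> x (i + k) \<le> lam ! i"
    and i: "i < length lam"
  shows "nu_list lam m t ! i \<in> {min (c_lam_m lam m t) (x i)..max (c_lam_m lam m t) (x i)}"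
proof -
  note dec' = sorted_wrt_ge_nth[OF dec]
  define c \<rho> r where "c = c_lam_m lam m t" and "\<rho> = r_lam_m lam m t" and "r = max \<rho> m"
  have ml: "m < length lam" using ne m by (cases lam) auto
  have rm: "\<rho> < length lam" "lam ! \<rho> \<le> c" "\<And>i. i < \<rho> \<Longrightarrow> c < lam ! i"
    using r_lam_m_props[OF ne dec t ml] unfolding c_def \<rho>_def by auto
  note nth = nu_list_nth[OF ne dec t ml c_def \<rho>_def r_def i]
  show ?thesis
  proof (cases "i < \<rho> \<or> i < \<rho> + (length lam - r)")
    case True
    then show ?thesis using nth rm(3)[of i] x[OF i] unfolding c_def[symmetric]
      by (auto simp: less_imp_le)
  next
    case False
    \<comment> \<open>With r = rho the first two blocks would already fill all d places. As m is
      positive, the subtraction defining it is not truncated, so the middle block has length exactly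
      k.\<close>
    then have "r = m" "m > \<rho>" using i rm(1) unfolding r_def by (auto simp: max_def split: if_splits)
    then have k: "length lam - r = k" using m by simp
    have "\<rho> \<le> i - k" "i - k < length lam" using False i k by auto
    then have le: "lam ! (i - k) \<le> c" using dec'[of \<rho> "i - k"] rm(2) by linarith
    have "x i \<le> lam ! (i - k)" using xk[of "i - k"] False i k by simp
    then show ?thesis using nth False le k unfolding c_def[symmetric] by auto
  qed
qed

section \<open>Completions of a frame\<close>

lemma sum_list_eigenvalue_vector:
  assumes "set F \<subseteq> carrier_vec d"
  shows "(\<Sum>i<d. eigenvalue_vector (frame_operator d F) ! i) = (\<Sum>g\<leftarrow>F. sqnorm g)"
    "sum_list (eigenvalue_vector (frame_operator d F)) = (\<Sum>g\<leftarrow>F. sqnorm g)"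
proof -
  obtain U where U: "diagonalizes d (frame_operator d F) U (\<lambda>i. eigenvalue_vector (frame_operator d F) ! i)"
    by (rule frame_operator_diagonalizes[OF assms])
  then show *: "(\<Sum>i<d. eigenvalue_vector (frame_operator d F) ! i) = (\<Sum>g\<leftarrow>F. sqnorm g)"
    using mat_trace_diagonalizes[OF U] frame_operator_trace[OF assms] by simp
  have "sum_list (eigenvalue_vector (frame_operator d F)) = (\<Sum>i<d. eigenvalue_vector (frame_operator d F) ! i)"
    by (simp add: sum_list_sum_nth frame_operator_eigenvalue_vector(1)[OF assms] lessThan_atLeast0)
  with * show "sum_list (eigenvalue_vector (frame_operator d F)) = (\<Sum>g\<leftarrow>F. sqnorm g)" by simp
qed

text \<open>A unit eigenvector scaled by the root of w l contributes w l to its eigenvalue and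
  nothing to the others.\<close>

lemma frame_operator_scaled_cols:
  assumes U: "U \<in> carrier_mat d d" and w: "\<And>j. r \<le> j \<Longrightarrow> j < d \<Longrightarrow> w j \<ge> 0" and ij: "i < d" "j < d"
  shows "frame_operator d (map (\<lambda>l. complex_of_real (sqrt (w l)) \<cdot>\<^sub>v col U l) [r..<d]) $$ (i, j) =
    (\<Sum>l<d. U $$ (i, l) * complex_of_real (if r \<le> l then w l else 0) * cnj (U $$ (j, l)))"
proof -
  let ?hs = "map (\<lambda>l. complex_of_real (sqrt (w l)) \<cdot>\<^sub>v col U l) [r..<d]"
  have hs: "set ?hs \<subseteq> carrier_vec d" using U by auto
  have "frame_operator d ?hs $$ (i, j) = (\<Sum>h\<leftarrow>?hs. h $ i * cnj (h $ j))"
    by (rule frame_operator_index[OF hs ij])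
  also have "\<dots> = (\<Sum>l\<leftarrow>[r..<d]. U $$ (i, l) * complex_of_real (if r \<le> l then w l else 0) * cnj (U $$ (j, l)))"
    unfolding map_map
  proof (intro arg_cong[of _ _ sum_list] map_cong refl)
    fix l assume "l \<in> set [r..<d]"
    then have l: "r \<le> l" "l < d" by auto
    have "complex_of_real (sqrt (w l)) * complex_of_real (sqrt (w l)) = complex_of_real (w l)"
      using w[OF l] by (simp flip: of_real_mult)
    then show "((\<lambda>h. h $ i * cnj (h $ j)) \<circ> (\<lambda>l. complex_of_real (sqrt (w l)) \<cdot>\<^sub>v col U l)) l =
      U $$ (i, l) * complex_of_real (if r \<le> l then w l else 0) * cnj (U $$ (j, l))"
      using U l ij by (simp add: algebra_simps)
  qed
  also have "\<dots> = (\<Sum>l\<in>{r..<d}. U $$ (i, l) * complex_of_real (if r \<le> l then w l else 0) * cnj (U $$ (j, l)))"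
    by (simp add: interv_sum_list_conv_sum_set_nat)
  also have "\<dots> = (\<Sum>l<d. U $$ (i, l) * complex_of_real (if r \<le> l then w l else 0) * cnj (U $$ (j, l)))"
    by (intro sum.mono_neutral_left) auto
  finally show ?thesis .
qed

text \<open>The rank hypothesis is stated additively, which is the integer inequality without
  truncated subtraction.\<close>

locale frame_completion =
  fixes d :: nat and F0 :: "complex vec list" and a :: "real list"
  assumes F0: "set F0 \<subseteq> carrier_vec d"
    and len: "length F0 < length a"
    and rk: "d \<le> vec_space.rank d (frame_operator d F0) + (length a - length F0)"
    and a_pos: "\<And>i. i < length a \<Longrightarrow> a ! i > 0"
    and norms: "\<And>i. i < length F0 \<Longrightarrow> sqnorm (F0 ! i) = a ! i"
    and maj: "drop (length F0) a \<prec>\<^sub>m mu_vec d F0 a"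
begin

definition lam :: "real list" where "lam = eigenvalue_vector (frame_operator d F0)"
definition k :: nat where "k = length a - length F0"
definition t :: real where "t = sum_list a"
definition c :: real where "c = c_lam_m lam (d - k) t"
definition r :: nat where "r = max (r_lam_m lam (d - k) t) (d - k)"

lemma length_lam: "length lam = d"
  using frame_operator_eigenvalue_vector(1)[OF F0] by (simp add: lam_def)

lemma lam_decreasing: "sorted_wrt (\<ge>) lam"
  using frame_operator_eigenvalue_vector(2)[OF F0]
  unfolding sorted_wrt_iff_nth_less length_lam by (auto simp: lam_def)

lemma mu_vec_eq: "mu_vec d F0 a = map (\<lambda>j. c - lam ! j) [r..<d]"
  by (simp add: mu_vec_def mu_list_def Let_def c_def r_def t_def lam_def[symmetric] k_def[symmetric]
      length_lam)

lemma nu_vec_eq: "nu_vec d F0 a = nu_list lam (d - k) t"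
  by (simp add: nu_vec_def lam_def k_def t_def)

lemma k_pos: "k > 0"
  using len by (simp add: k_def)

lemma sum_list_new_norms_pos: "sum_list (drop (length F0) a) > 0"
proof -
  obtain b bs where b: "drop (length F0) a = b # bs" using len by (cases "drop (length F0) a") auto
  have "x > 0" if "x \<in> set (b # bs)" for x
    using that a_pos unfolding b[symmetric] by (metis in_set_conv_nth in_set_dropD)
  then show ?thesis unfolding b by (simp add: add_pos_nonneg sum_list_nonneg less_imp_le)
qed

lemma sum_list_mu_pos: "sum_list (map (\<lambda>j. c - lam ! j) [r..<d]) > 0"
  using maj sum_list_new_norms_pos unfolding majorized_def Let_def mu_vec_eq by simp

lemma lam_nonneg:
  assumes "j < d"
  shows "lam ! j \<ge> 0"
proof -
  obtain U where "diagonalizes d (frame_operator d F0) U (\<lambda>i. lam ! i)"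
    unfolding lam_def by (rule frame_operator_diagonalizes[OF F0])
  then show ?thesis using frame_operator_eigenvalue_nonneg[OF F0 _ assms] by blast
qed

text \<open>The numbers c - lam_j have a positive sum although no lam_j is negative. Positivity of c
  supplies the supporting line at c.\<close>

lemma c_pos: "c > 0"
proof (rule ccontr)
  assume *: "\<not> c > 0"
  have "sum_list (map (\<lambda>j. c - lam ! j) [r..<d]) \<le> 0"
  proof (rule sum_list_nonpos)
    fix x assume "x \<in> set (map (\<lambda>j. c - lam ! j) [r..<d])"
    then obtain j where "j < d" "x = c - lam ! j" by auto
    then show "x \<le> 0" using lam_nonneg[of j] * by simp
  qed
  then show False using sum_list_mu_pos by simp
qed

text \<open>For d = 0 the vector mu would be empty, against its positive sum; with k > 0 it follows
  that d - k < d.\<close>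

lemma lam_nonempty: "lam \<noteq> []" and m_less: "d - k < length lam"
proof -
  have "d > 0" using sum_list_mu_pos by (cases d) auto
  then show "lam \<noteq> []" "d - k < length lam" using length_lam k_pos by auto
qed

lemma sum_list_lam_le: "sum_list lam \<le> t"
proof -
  have "sum_list lam = (\<Sum>g\<leftarrow>F0. sqnorm g)"
    using sum_list_eigenvalue_vector(2)[OF F0] by (simp add: lam_def)
  also have "map sqnorm F0 = take (length F0) a"
    using norms len by (intro nth_equalityI) auto
  finally have "t = sum_list lam + sum_list (drop (length F0) a)"
    unfolding t_def by (metis append_take_drop_id sum_list_append)
  then show ?thesis using sum_list_new_norms_pos by simp
qed

lemmas nu_facts = nu_list_facts[OF lam_nonempty lam_decreasing sum_list_lam_le m_less c_def r_def]

text \<open>Before rho the entries exceed c > 0. From there up to d - k, an entry 0 at index j would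
  bound the rank of the frame operator by j < d - k, against the rank hypothesis.\<close>

lemma lam_pos:
  assumes "j < r"
  shows "lam ! j > 0"
proof (cases "j < r_lam_m lam (d - k) t")
  case True
  then show ?thesis
    using r_lam_m_props(3)[OF lam_nonempty lam_decreasing sum_list_lam_le m_less] c_pos
    by (fastforce simp: c_def)
next
  case False
  then have j: "j < d - k" using assms by (auto simp: r_def)
  obtain U where U: "diagonalizes d (frame_operator d F0) U (\<lambda>i. lam ! i)"
    unfolding lam_def by (rule frame_operator_diagonalizes[OF F0])
  show ?thesis
  proof (rule ccontr)
    assume *: "\<not> lam ! j > 0"
    have "lam ! i = 0" if "j \<le> i" "i < d" for i
      using sorted_wrt_ge_nth[OF lam_decreasing, of j i] lam_nonneg[of i] that * length_lam by simp
    then have "vec_space.rank d (frame_operator d F0) \<le> j"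
      using j by (intro diagonalizes_rank_le[OF U]) auto
    then show False using rk j by (simp add: k_def)
  qed
qed

section \<open>Spectra of completions, existence of an optimal one, and minimality\<close>

lemma completionsD:
  assumes "G \<in> completions d F0 a"
  shows "G \<in> frames (length a) d" "set G \<subseteq> carrier_vec d" "G = F0 @ drop (length F0) G"
    "length (drop (length F0) G) = k" "(\<Sum>g\<leftarrow>G. sqnorm g) = t"
proof -
  show "G \<in> frames (length a) d" "set G \<subseteq> carrier_vec d"
    using assms by (auto simp: completions_def frames_def)
  have lenG: "length G = length a" and G: "take (length F0) G = F0"
    "\<And>i. length F0 \<le> i \<Longrightarrow> i < length a \<Longrightarrow> sqnorm (G ! i) = a ! i"
    using assms by (auto simp: completions_def frames_def)
  show "G = F0 @ drop (length F0) G" using G(1) by (metis append_take_drop_id)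
  show "length (drop (length F0) G) = k" using lenG by (simp add: k_def)
  have "map sqnorm G = a"
  proof (rule nth_equalityI)
    fix i assume "i < length (map sqnorm G)"
    then have i: "i < length a" using lenG by simp
    show "map sqnorm G ! i = a ! i"
    proof (cases "i < length F0")
      case True
      then have "G ! i = F0 ! i" using G(1) by (metis nth_take)
      then show ?thesis using True norms i lenG by simp
    qed (use G(2) i lenG in simp)
  qed (use lenG in simp)
  then show "(\<Sum>g\<leftarrow>G. sqnorm g) = t" by (simp add: t_def)
qed

lemma completion_spectrum_between:
  assumes G: "G \<in> completions d F0 a" and i: "i < d"
  shows "nu_vec d F0 a ! i \<in> {min c (eigenvalue_vector (frame_operator d G) ! i)..
    max c (eigenvalue_vector (frame_operator d G) ! i)}"
  unfolding nu_vec_eq c_def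
proof (rule nu_list_between[OF lam_nonempty lam_decreasing sum_list_lam_le, of "d - k" k])
  note GD = completionsD[OF G]
  have cd: "set (drop (length F0) G) \<subseteq> carrier_vec d" using GD(2) by (meson set_drop_subset order_trans)
  show "lam ! i \<le> eigenvalue_vector (frame_operator d G) ! i" if "i < length lam" for i
    using frame_operator_eigenvalues_append_ge[OF F0 cd, of i] that length_lam GD(3)
    by (simp add: lam_def)
  show "eigenvalue_vector (frame_operator d G) ! (i + k) \<le> lam ! i" if "i + k < length lam" for i
    using frame_operator_eigenvalues_append_le[OF F0 cd, of i] that length_lam GD(3,4)
    by (simp add: lam_def)
qed (use length_lam k_pos i in auto)

lemma completion_spectrum_pos:
  assumes G: "G \<in> completions d F0 a" and i: "i < d"
  shows "eigenvalue_vector (frame_operator d G) ! i > 0"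
proof -
  obtain U where "diagonalizes d (frame_operator d G) U (\<lambda>i. eigenvalue_vector (frame_operator d G) ! i)"
    by (rule frame_operator_diagonalizes[OF completionsD(2)[OF G]])
  then show ?thesis using frame_eigenvalue_pos[OF completionsD(1)[OF G] _ i] by blast
qed

lemma completion_spectrum_sum:
  assumes G: "G \<in> completions d F0 a"
  shows "(\<Sum>i<d. nu_vec d F0 a ! i) = (\<Sum>i<d. eigenvalue_vector (frame_operator d G) ! i)"
proof -
  have "(\<Sum>i<d. nu_vec d F0 a ! i) = sum_list (nu_vec d F0 a)"
    by (simp add: sum_list_sum_nth nu_vec_eq nu_facts(3) length_lam lessThan_atLeast0)
  also have "\<dots> = t" by (simp add: nu_vec_eq nu_facts(5))
  also have "\<dots> = (\<Sum>i<d. eigenvalue_vector (frame_operator d G) ! i)"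
    using sum_list_eigenvalue_vector(1)[OF completionsD(2)[OF G]] completionsD(5)[OF G] by simp
  finally show ?thesis .
qed

lemma ex_optimal_completion:
  "\<exists>F \<in> completions d F0 a. eigenvalue_vector (frame_operator d F) = nu_vec d F0 a"
proof -
  obtain U where S: "diagonalizes d (frame_operator d F0) U (\<lambda>i. lam ! i)"
    unfolding lam_def by (rule frame_operator_diagonalizes[OF F0])
  then have U: "U \<in> carrier_mat d d" "mat_adjoint U * U = 1\<^sub>m d"
    and S': "frame_operator d F0 = U * mat_diag d (\<lambda>i. complex_of_real (lam ! i)) * mat_adjoint U"
    by (auto simp: diagonalizes_def)
  have w: "c - lam ! j \<ge> 0" if "r \<le> j" "j < d" for j using nu_facts(2)[of j] that length_lam by simp
  \<comment> \<open>Each trailing eigenvalue is raised to c along its own eigenvector; the squared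
    norms needed for this are exactly the entries of mu.\<close>
  define hs where "hs = map (\<lambda>j. complex_of_real (sqrt (c - lam ! j)) \<cdot>\<^sub>v col U j) [r..<d]"
  have hs: "set hs \<subseteq> carrier_vec d" using U by (auto simp: hs_def)
  have "sqnorm (complex_of_real (sqrt (c - lam ! j)) \<cdot>\<^sub>v col U j) = c - lam ! j" if "r \<le> j" "j < d" for j
  proof -
    have "complex_of_real (sqnorm (col U j)) = 1"
      using cscalar_prod_col_unitary[OF U that(2) that(2)] by (simp flip: cscalar_prod_self)
    then show ?thesis using w[OF that] by (simp add: sqnorm_smult)
  qed
  then have hs_mu: "map sqnorm hs = mu_vec d F0 a"
    by (simp add: hs_def mu_vec_eq comp_def)
  \<comment> \<open>There are d - r of these vectors, and r is at least d - k, so k norms leave room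
    for all of them.\<close>
  have "length hs \<le> length (drop (length F0) a)"
    by (simp add: hs_def r_def k_def)
  then obtain gs where gs: "set gs \<subseteq> carrier_vec d" "map sqnorm gs = drop (length F0) a"
    "frame_operator d gs = frame_operator d hs"
    using schur_horn[OF hs _ maj[folded hs_mu]] by blast
  define F where "F = F0 @ gs"
  define l where "l j = (if j < r then lam ! j else c)" for j
  have Fc: "set F \<subseteq> carrier_vec d" using F0 gs by (simp add: F_def)
  have "frame_operator d F = U * mat_diag d (\<lambda>i. complex_of_real (l i)) * mat_adjoint U"
  proof (rule eq_matI)
    fix i j assume "i < dim_row (U * mat_diag d (\<lambda>i. complex_of_real (l i)) * mat_adjoint U)"
      "j < dim_col (U * mat_diag d (\<lambda>i. complex_of_real (l i)) * mat_adjoint U)"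
    then have ij: "i < d" "j < d" using U by auto
    have "frame_operator d F $$ (i, j) = frame_operator d F0 $$ (i, j) + frame_operator d hs $$ (i, j)"
      using ij F0 gs hs by (simp add: F_def frame_operator_append)
    also have "\<dots> = (\<Sum>q<d. U $$ (i, q) * complex_of_real (lam ! q) * cnj (U $$ (j, q))) +
      (\<Sum>q<d. U $$ (i, q) * complex_of_real (if r \<le> q then c - lam ! q else 0) * cnj (U $$ (j, q)))"
      unfolding hs_def S' diag_conj_index[OF U(1) ij] using frame_operator_scaled_cols[OF U(1) w ij] by simp
    also have "\<dots> = (\<Sum>q<d. U $$ (i, q) * complex_of_real (l q) * cnj (U $$ (j, q)))"
      unfolding sum.distrib[symmetric] by (intro sum.cong refl) (simp add: l_def algebra_simps)
    also have "\<dots> = (U * mat_diag d (\<lambda>i. complex_of_real (l i)) * mat_adjoint U) $$ (i, j)"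
      by (rule diag_conj_index[OF U(1) ij, symmetric])
    finally show "frame_operator d F $$ (i, j) = (U * mat_diag d (\<lambda>i. complex_of_real (l i)) * mat_adjoint U) $$ (i, j)" .
  qed (use U Fc in auto)
  then have T: "diagonalizes d (frame_operator d F) U l" using U by (simp add: diagonalizes_def)
  have lenF: "length F = length a"
    using arg_cong[OF gs(2), of length] len by (simp add: F_def)
  have "l i > 0" if "i < d" for i using lam_pos[of i] c_pos by (simp add: l_def)
  then have "F \<in> frames (length a) d" using framesI[OF Fc lenF T] by blast
  moreover have "sqnorm (F ! i) = a ! i" if "length F0 \<le> i" "i < length a" for i
  proof -
    have "i - length F0 < length gs" using that lenF by (simp add: F_def)
    then have "sqnorm (F ! i) = map sqnorm gs ! (i - length F0)" using that by (simp add: F_def nth_append)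
    then show ?thesis using that by (simp add: gs(2))
  qed
  ultimately have "F \<in> completions d F0 a" by (simp add: completions_def F_def)
  moreover have "eigenvalue_vector (frame_operator d F) = nu_vec d F0 a"
  proof -
    \<comment> \<open>The diagonal l has the entries of nu in another order; as nu is decreasing,
      sorting l recovers it.\<close>
    have "mset (rev (nu_vec d F0 a)) = mset (map l [0..<d])"
      using nu_facts(4) unfolding nu_vec_eq length_lam l_def by simp
    then have "sort (map l [0..<d]) = rev (nu_vec d F0 a)"
      using nu_facts(6) by (intro properties_for_sort) (simp_all add: nu_vec_eq)
    then show ?thesis using eigenvalue_vector_diagonalizes[OF T] by simp
  qed
  ultimately show ?thesis by blast
qed

text \<open>P stands for any functional that sums f over the spectrum, which covers the frame
  potentials, the Benedetto-Fickus potential and the mean square error at once.\<close>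

lemma optimal_spectrum_minimizes:
  assumes f: "convex_on {0<..} f" and F: "F \<in> completions d F0 a"
    and spec: "eigenvalue_vector (frame_operator d F) = nu_vec d F0 a" and G: "G \<in> completions d F0 a"
    and P: "\<And>G. G \<in> completions d F0 a \<Longrightarrow> P G = (\<Sum>i<d. f (eigenvalue_vector (frame_operator d G) ! i))"
  shows "(\<Sum>i<d. f (nu_vec d F0 a ! i)) = P F \<and> P F \<le> P G"
  using convex_sum_le[OF f c_pos completion_spectrum_pos[OF G] completion_spectrum_between[OF G]
      completion_spectrum_sum[OF G]] P[OF F] P[OF G] spec by simp

text \<open>A minimizer does at least as well as a completion with spectrum nu, whose existence is
  essential here; the equality case of the convex comparison then identifies the spectra.\<close>

lemma minimizer_spectrum:
  assumes f: "strictly_convex_on {0<..} f" and F: "is_arg_min P (\<lambda>F. F \<in> completions d F0 a) F"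
    and P: "\<And>G. G \<in> completions d F0 a \<Longrightarrow> P G = (\<Sum>i<d. f (eigenvalue_vector (frame_operator d G) ! i))"
  shows "eigenvalue_vector (frame_operator d F) = nu_vec d F0 a"
proof -
  obtain E where E: "E \<in> completions d F0 a" "eigenvalue_vector (frame_operator d E) = nu_vec d F0 a"
    using ex_optimal_completion by blast
  have Fc: "F \<in> completions d F0 a" and "P F \<le> P E"
    using F E(1) by (auto simp: is_arg_min_linorder)
  then have "(\<Sum>i<d. f (eigenvalue_vector (frame_operator d F) ! i)) \<le> (\<Sum>i<d. f (nu_vec d F0 a ! i))"
    using P[OF E(1)] P[OF Fc] E(2) by simp
  then have "nu_vec d F0 a ! i = eigenvalue_vector (frame_operator d F) ! i" if "i < d" for i
    using strictly_convex_sum_eqD[OF f c_pos completion_spectrum_pos[OF Fc] completion_spectrum_between[OF Fc]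
      completion_spectrum_sum[OF Fc]] that by blast
  moreover have "length (eigenvalue_vector (frame_operator d F)) = d" "length (nu_vec d F0 a) = d"
    using frame_operator_eigenvalue_vector(1)[OF completionsD(2)[OF Fc]] nu_facts(3) length_lam
    by (simp_all add: nu_vec_eq)
  ultimately show ?thesis by (intro nth_equalityI) auto
qed

lemma potentials_of_spectrum:
  assumes G: "G \<in> completions d F0 a"
  shows "frame_potential d f G = (\<Sum>i<d. f (eigenvalue_vector (frame_operator d G) ! i))"
    "benedetto_fickus_potential d G = (\<Sum>i<d. (eigenvalue_vector (frame_operator d G) ! i)\<^sup>2)"
    "mean_square_error d G = (\<Sum>i<d. 1 / eigenvalue_vector (frame_operator d G) ! i)"
proof -
  obtain U where U: "diagonalizes d (frame_operator d G) U (\<lambda>i. eigenvalue_vector (frame_operator d G) ! i)"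
    by (rule frame_operator_diagonalizes[OF completionsD(2)[OF G]])
  show "frame_potential d f G = (\<Sum>i<d. f (eigenvalue_vector (frame_operator d G) ! i))"
    using mat_trace_mat_fun[OF U] by (simp add: frame_potential_def)
  show "benedetto_fickus_potential d G = (\<Sum>i<d. (eigenvalue_vector (frame_operator d G) ! i)\<^sup>2)"
    using mat_trace_square[OF U] by (simp add: benedetto_fickus_potential_def)
  have "eigenvalue_vector (frame_operator d G) ! i \<noteq> 0" if "i < d" for i
    using completion_spectrum_pos[OF G that] by simp
  then show "mean_square_error d G = (\<Sum>i<d. 1 / eigenvalue_vector (frame_operator d G) ! i)"
    using mat_trace_inverse[OF U] by (simp add: mean_square_error_def)
qed

end

theorem theorem4p4:
  fixes d n0 n k :: nat
    and F0 :: "complex vec list"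
    and a b \<mu> \<nu> :: "real list"
  assumes F0: "length F0 = n0" "set F0 \<subseteq> carrier_vec d"
    and n: "n > n0"
    and k: "k = n - n0"
    and rk: "int (vec_space.rank d (frame_operator d F0)) \<ge> int d - int k"
    and a: "length a = n" "\<forall>i<n. a ! i > 0"
    and norms: "\<forall>i<n0. sqnorm (F0 ! i) = a ! i"
    and b: "b = drop n0 a"
    and \<nu>: "\<nu> = nu_vec d F0 a"
    and \<mu>: "\<mu> = mu_vec d F0 a"
    and maj: "b \<prec>\<^sub>m \<mu>"
  shows
    "(\<forall>F \<in> completions d F0 a. eigenvalue_vector (frame_operator d F) = \<nu> \<longrightarrow>
       (\<forall>G \<in> completions d F0 a. \<forall>f. convex_on {0..} f \<and> (\<forall>x\<ge>0. f x \<ge> 0) \<longrightarrow>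
          (\<Sum>i<d. f (\<nu> ! i)) = frame_potential d f F \<and>
          frame_potential d f F \<le> frame_potential d f G)) \<and>
     (\<forall>f. strictly_convex_on {0..} f \<and> (\<forall>x\<ge>0. f x \<ge> 0) \<longrightarrow>
       (\<forall>F'. is_arg_min (frame_potential d f) (\<lambda>F. F \<in> completions d F0 a) F' \<longrightarrow>
          eigenvalue_vector (frame_operator d F') = \<nu>)) \<and>
     (\<forall>F \<in> completions d F0 a. eigenvalue_vector (frame_operator d F) = \<nu> \<longrightarrow>
       (\<forall>G \<in> completions d F0 a.
          (\<Sum>i<d. (\<nu> ! i)\<^sup>2) = benedetto_fickus_potential d F \<and>
          benedetto_fickus_potential d F \<le> benedetto_fickus_potential d G)) \<and>
     (\<forall>F'. is_arg_min (benedetto_fickus_potential d) (\<lambda>F. F \<in> completions d F0 a) F' \<longrightarrow>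
       eigenvalue_vector (frame_operator d F') = \<nu>) \<and>
     (\<forall>F \<in> completions d F0 a. eigenvalue_vector (frame_operator d F) = \<nu> \<longrightarrow>
       (\<forall>G \<in> completions d F0 a.
          (\<Sum>i<d. 1 / \<nu> ! i) = mean_square_error d F \<and>
          mean_square_error d F \<le> mean_square_error d G)) \<and>
     (\<forall>F'. is_arg_min (mean_square_error d) (\<lambda>F. F \<in> completions d F0 a) F' \<longrightarrow>
       eigenvalue_vector (frame_operator d F') = \<nu>)"
proof -
  interpret frame_completion d F0 a
    by unfold_locales (use F0 n k rk a norms b \<mu> maj in auto)
  note square = strictly_convex_on_square and inverse = strictly_convex_on_inverse
  note convex = strictly_convex_on_imp_convex_on
  \<comment> \<open>The common domain is the open half line, where 1/x is convex; with the
    convention 1/0 = 0 it would not be convex on the closed one.\<close>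
  have restrict: "convex_on {0<..} f" if "convex_on {0..} f" for f :: "real \<Rightarrow> real"
    by (rule convex_on_subset[OF that]) auto
  have strict_restrict: "strictly_convex_on {0<..} f" if "strictly_convex_on {0..} f" for f
    by (rule strictly_convex_on_subset[OF that]) auto
  show ?thesis
    unfolding \<nu>
  proof (intro conjI ballI allI impI)
    fix F G and f :: "real \<Rightarrow> real"
    assume F: "F \<in> completions d F0 a" "eigenvalue_vector (frame_operator d F) = nu_vec d F0 a"
      and G: "G \<in> completions d F0 a" and f: "convex_on {0..} f \<and> (\<forall>x\<ge>0. 0 \<le> f x)"
    have "(\<Sum>i<d. f (nu_vec d F0 a ! i)) = frame_potential d f F \<and> frame_potential d f F \<le> frame_potential d f G"
      by (rule optimal_spectrum_minimizes[OF restrict F G potentials_of_spectrum(1)]) (use f in auto)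
    then show "(\<Sum>i<d. f (nu_vec d F0 a ! i)) = frame_potential d f F"
      "frame_potential d f F \<le> frame_potential d f G" by auto
  next
    fix f :: "real \<Rightarrow> real" and F'
    assume f: "strictly_convex_on {0..} f \<and> (\<forall>x\<ge>0. 0 \<le> f x)"
      and F': "is_arg_min (frame_potential d f) (\<lambda>F. F \<in> completions d F0 a) F'"
    show "eigenvalue_vector (frame_operator d F') = nu_vec d F0 a"
      by (rule minimizer_spectrum[OF strict_restrict F' potentials_of_spectrum(1)]) (use f in auto)
  next
    fix F G
    assume F: "F \<in> completions d F0 a" "eigenvalue_vector (frame_operator d F) = nu_vec d F0 a"
      and G: "G \<in> completions d F0 a"
    note bf = optimal_spectrum_minimizes[OF convex[OF square] F G potentials_of_spectrum(2)]
    show "(\<Sum>i<d. (nu_vec d F0 a ! i)\<^sup>2) = benedetto_fickus_potential d F" using bf by blast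
    show "benedetto_fickus_potential d F \<le> benedetto_fickus_potential d G" using bf by blast
    note mse = optimal_spectrum_minimizes[OF convex[OF inverse] F G potentials_of_spectrum(3)]
    show "(\<Sum>i<d. 1 / nu_vec d F0 a ! i) = mean_square_error d F" using mse by blast
    show "mean_square_error d F \<le> mean_square_error d G" using mse by blast
  next
    fix F' assume "is_arg_min (benedetto_fickus_potential d) (\<lambda>F. F \<in> completions d F0 a) F'"
    then show "eigenvalue_vector (frame_operator d F') = nu_vec d F0 a"
      using minimizer_spectrum[OF square _ potentials_of_spectrum(2)] by blast
  next
    fix F' assume "is_arg_min (mean_square_error d) (\<lambda>F. F \<in> completions d F0 a) F'"
    then show "eigenvalue_vector (frame_operator d F') = nu_vec d F0 a"
      using minimizer_spectrum[OF inverse _ potentials_of_spectrum(3)] by blast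
  qed
qed

end
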